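(* Let $p$ be a prime, $q=p^a$, and let $K \subseteq \mathbb{R}^n$ be a convex polytope with integral vertices. Let $\bar{F} \in \mathbb{F}_q[x_1^{\pm1},\dots,x_n^{\pm1}]$ be a non-zero Laurent polynomial with $\Delta(\bar{F}) \subseteq K$, and let $V$ be the hypersurface in the torus $\mathbb{T}^n_{\mathbb{F}_q}$ cut out by $\bar{F}$. Let $F \in \mathbb{Z}_q[x_1^{\pm1},\dots,x_n^{\pm1}]$ be any lift of $\bar{F}$ (i.e. $F$ reduces modulo $p$ to $\bar F$) with $\Delta(F) \subseteq K$. Let $r, \lambda, \tau$ be positive integers satisfying $\tau \geq \frac{\lambda}{(p-1)ar}$. Then \[\lvert V(\mathbb{F}_{q^r})\rvert \equiv (q^r-1)^n \sum_{s = 0}^{\lambda + \tau - 1} \alpha_s \,\mathrm{tr}(A_{F^s}^{ar}) \pmod {p^\lambda},\] where \[\alpha_s = (-1)^s \sum_{t=0}^{\tau-1} \binom{-\lambda}{t} \binom{\lambda}{s-t} \in \mathbb{Z},\] and where $A_{F^s}^{a}$ is regarded as a $\mathbb{Z}_q$-linear operator on the $\mathbb{Z}_q$-module $P_{sK}$ (so $A_{F^s}^{ar}=(A_{F^s}^a)^r$ has a well-defined trace in $\mathbb{Z}_q$).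
   Context: For a domain $R$, $R[x^{\pm}]$ denotes $R[x_1^{\pm1},\dots,x_n^{\pm1}]$, and for $G \in R[x^{\pm}]$ and $u\in\mathbb{Z}^n$, $[G]_u$ is the coefficient of $x^u=x_1^{u_1}\cdots x_n^{u_n}$ in $G$. The Newton polytope $\Delta(G)$ is the convex hull in $\mathbb{R}^n$ of $\{u \in \mathbb{Z}^n : [G]_u \neq 0\}$. For a convex polytope $K$ with integral vertices, $sK$ is its $s$-fold dilation ($0K=\{0\}$), $K_\mathbb{Z}=K\cap\mathbb{Z}^n$, and $P_K = \bigoplus_{u \in K_\mathbb{Z}} \mathbb{Z}_q\, x^u$. $\mathbb{T}^n_{\mathbb{F}_q}=\{x_1\cdots x_n\neq 0\}\subseteq\mathbb{A}^n_{\mathbb{F}_q}$, and $V(\mathbb{F}_{q^r}) = \{c \in (\mathbb{F}_{q^r}^* )^n : \bar{F}(c) = 0\}$. $\mathbb{Q}_q$ is the unramified extension of $\mathbb{Q}_p$ of degree $a$ with ring of integers $\mathbb{Z}_q$, and $\phi:\mathbb{Z}_q\to\mathbb{Z}_q$ is the lift of the absolute Frobenius $c\mapsto c^p$ of $\mathbb{F}_q$. Define $\phi,\psi:\mathbb{Z}_q[x^{\pm}]\to\mathbb{Z}_q[x^{\pm}]$ by $\phi(G)=\sum_u \phi([G]_u)x^{pu}$ and $\psi(G)=\sum_u \phi^{-1}([G]_{pu})x^u$. For $H\in\mathbb{Z}_q[x^{\pm}]$, $T_H$ is multiplication by $H$ and $A_H=\psi\circ T_{H^{p-1}}$ (a $\phi^{-1}$-semilinear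 map, which maps $P_K$ into itself when $\Delta(H)\subseteq K$; $A_H^a$ is $\mathbb{Z}_q$-linear). Binomial coefficients with negative upper entry are the generalized ones, $\binom{-\lambda}{t}=(-\lambda)(-\lambda-1)\cdots(-\lambda-t+1)/t!$, and $\binom{\lambda}{j}=0$ for $j<0$ or $j>\lambda$. *)

theory Defs
  imports "HOL-Analysis.Analysis" "HOL-Library.Poly_Mapping"
    "HOL-Computational_Algebra.Primes"
begin

definition ring_hom_on :: "'a::comm_ring_1 set \<Rightarrow> ('a \<Rightarrow> 'b::comm_ring_1) \<Rightarrow> bool" where
  "ring_hom_on S f \<longleftrightarrow> f 1 = 1 \<and>
     (\<forall>x\<in>S. \<forall>y\<in>S. f (x + y) = f x + f y \<and> f (x * y) = f x * f y)"


text \<open>The function \<open>v\<close> is the absolute value extending the \<open>p\<close>-adic one, normalised by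
  \<open>v p = 1/p\<close>; it therefore restricts to the \<open>p\<close>-adic absolute value on \<open>\<rat>\<close>.\<close>

locale padic_valued_field =
  fixes p :: nat and v :: "'Q::field_char_0 \<Rightarrow> real"
  assumes prime_p: "prime p"
    and v_nonneg: "v x \<ge> 0"
    and v_eq_0: "v x = 0 \<longleftrightarrow> x = 0"
    and v_mult: "v (x * y) = v x * v y"
    and v_add: "v (x + y) \<le> max (v x) (v y)"
    and v_p: "v (of_nat p) = 1 / real p"
    and v_complete:
      "(\<forall>e>0. \<exists>N::nat. \<forall>m\<ge>N. \<forall>n\<ge>N. v (X m - X n) < e) \<Longrightarrow>
         \<exists>L. \<forall>e>0. \<exists>N. \<forall>n\<ge>N. v (X n - L) < e"

text \<open>Inside a complete field as above, \<open>\<rat>\<^sub>p\<close> (the completion of \<open>\<rat>\<close>) is the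
  closure of \<open>\<rat>\<close>.\<close>

definition padic_subfield :: "('Q::field_char_0 \<Rightarrow> real) \<Rightarrow> 'Q set" where
  "padic_subfield v = {x. \<forall>e>0. \<exists>y\<in>\<rat>. v (x - y) < e}"

definition field_basis :: "'Q::field set \<Rightarrow> 'Q set \<Rightarrow> bool" where
  "field_basis k B \<longleftrightarrow> finite B \<and> (\<forall>x. \<exists>!c. c \<in> B \<rightarrow>\<^sub>E k \<and> x = (\<Sum>b\<in>B. c b * b))"

text \<open>The field \<open>\<rat>\<^sub>q\<close>, \<open>q = p^a\<close>: an extension of \<open>\<rat>\<^sub>p\<close> of degree \<open>a\<close> with
  ramification index 1, i.e. with the same value group as \<open>\<rat>\<^sub>p\<close>.\<close>

locale unramified_padic_field = padic_valued_field p v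
  for p :: nat and a :: nat and v :: "'Q::field_char_0 \<Rightarrow> real" +
  assumes degree: "\<exists>B. field_basis (padic_subfield v) B \<and> card B = a"
    and unramified: "x \<noteq> 0 \<Longrightarrow> \<exists>k::int. v x = real p powi k"

definition integer_ring :: "('Q::field_char_0 \<Rightarrow> real) \<Rightarrow> 'Q set" where
  "integer_ring v = {x. v x \<le> 1}"

definition cong_pow :: "nat \<Rightarrow> ('Q::field_char_0 \<Rightarrow> real) \<Rightarrow> nat \<Rightarrow> 'Q \<Rightarrow> 'Q \<Rightarrow> bool" where
  "cong_pow p v m x y \<longleftrightarrow> (\<exists>z\<in>integer_ring v. x - y = of_nat p ^ m * z)"

definition reduction_map ::
    "nat \<Rightarrow> ('Q::field_char_0 \<Rightarrow> real) \<Rightarrow> ('Q \<Rightarrow> 'k::field) \<Rightarrow> bool" where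
  "reduction_map p v red \<longleftrightarrow>
     ring_hom_on (integer_ring v) red \<and> red ` integer_ring v = UNIV \<and>
     (\<forall>x\<in>integer_ring v. red x = 0 \<longleftrightarrow> cong_pow p v 1 x 0)"

definition frobenius_lift ::
    "nat \<Rightarrow> ('Q::field_char_0 \<Rightarrow> real) \<Rightarrow> ('Q \<Rightarrow> 'Q) \<Rightarrow> bool" where
  "frobenius_lift p v \<phi> \<longleftrightarrow>
     ring_hom_on (integer_ring v) \<phi> \<and> bij_betw \<phi> (integer_ring v) (integer_ring v) \<and>
     (\<forall>x\<in>integer_ring v. cong_pow p v 1 (\<phi> x) (x ^ p))"


text \<open>Laurent polynomials in variables indexed by \<open>'n\<close> are the group algebra of \<open>int ^ 'n\<close>;
  the coefficient of \<open>x^u\<close> in \<open>G\<close> is \<open>Poly_Mapping.lookup G u\<close>.\<close>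

type_synonym ('n, 'a) laurent = "(int ^ 'n) \<Rightarrow>\<^sub>0 'a"

definition real_point :: "int ^ 'n \<Rightarrow> real ^ 'n" where
  "real_point u = (\<chi> i. real_of_int (u $ i))"

definition newton_polytope :: "('n::finite, 'a::zero) laurent \<Rightarrow> (real ^ 'n) set" where
  "newton_polytope G = convex hull (real_point ` {u. Poly_Mapping.lookup G u \<noteq> 0})"

definition laurent_eval ::
    "('k::field \<Rightarrow> 'l::field) \<Rightarrow> ('n::finite, 'k) laurent \<Rightarrow> 'l ^ 'n \<Rightarrow> 'l" where
  "laurent_eval \<iota> G c =
     (\<Sum>u\<in>Poly_Mapping.keys G. \<iota> (Poly_Mapping.lookup G u) *
        (\<Prod>i\<in>UNIV. (c $ i) powi (u $ i)))"

definition torus_points ::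
    "('k::field \<Rightarrow> 'l::field) \<Rightarrow> ('n::finite, 'k) laurent \<Rightarrow> ('l ^ 'n) set" where
  "torus_points \<iota> G = {c. (\<forall>i. c $ i \<noteq> 0) \<and> laurent_eval \<iota> G c = 0}"

definition integral_polytope :: "(real ^ 'n::finite) set \<Rightarrow> bool" where
  "integral_polytope K \<longleftrightarrow> polytope K \<and> (\<forall>x. x extreme_point_of K \<longrightarrow> (\<forall>i. x $ i \<in> \<int>))"

definition dilate :: "nat \<Rightarrow> (real ^ 'n::finite) set \<Rightarrow> (real ^ 'n) set" where
  "dilate s K = (\<lambda>x. real s *\<^sub>R x) ` K"

definition lattice_points :: "(real ^ 'n::finite) set \<Rightarrow> (int ^ 'n) set" where
  "lattice_points K = {u. real_point u \<in> K}"

definition integral_laurent ::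
    "('Q::field_char_0 \<Rightarrow> real) \<Rightarrow> ('n::finite, 'Q) laurent set" where
  "integral_laurent v = {G. \<forall>u. Poly_Mapping.lookup G u \<in> integer_ring v}"

definition P_module ::
    "('Q::field_char_0 \<Rightarrow> real) \<Rightarrow> (real ^ 'n::finite) set \<Rightarrow> ('n, 'Q) laurent set" where
  "P_module v K = {G \<in> integral_laurent v. Poly_Mapping.keys G \<subseteq> lattice_points K}"

definition psi ::
    "nat \<Rightarrow> ('Q::field_char_0 \<Rightarrow> real) \<Rightarrow> ('Q \<Rightarrow> 'Q) \<Rightarrow>
     ('n::finite, 'Q) laurent \<Rightarrow> ('n, 'Q) laurent" where
  "psi p v \<phi> G =
     (\<Sum>u | int p *s u \<in> Poly_Mapping.keys G.
        Poly_Mapping.single u (inv_into (integer_ring v) \<phi> (Poly_Mapping.lookup G (int p *s u))))"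

definition A_op ::
    "nat \<Rightarrow> ('Q::field_char_0 \<Rightarrow> real) \<Rightarrow> ('Q \<Rightarrow> 'Q) \<Rightarrow>
     ('n::finite, 'Q) laurent \<Rightarrow> ('n, 'Q) laurent \<Rightarrow> ('n, 'Q) laurent" where
  "A_op p v \<phi> H = psi p v \<phi> \<circ> (\<lambda>G. H ^ (p - 1) * G)"

text \<open>Trace of a linear operator on the free module \<open>P_module v K\<close>, computed in its basis of
  monomials \<open>x^u\<close>.\<close>

definition P_trace ::
    "(real ^ 'n::finite) set \<Rightarrow> (('n, 'Q::field_char_0) laurent \<Rightarrow> ('n, 'Q) laurent) \<Rightarrow> 'Q" where
  "P_trace K T = (\<Sum>u\<in>lattice_points K. Poly_Mapping.lookup (T (Poly_Mapping.single u 1)) u)"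

definition alpha :: "nat \<Rightarrow> nat \<Rightarrow> nat \<Rightarrow> rat" where
  "alpha l \<tau> s = (-1) ^ s *
     (\<Sum>t<\<tau>. ((- of_nat l) gchoose t) * (if t \<le> s then of_nat (l choose (s - t)) else 0))"


lemma inj_scale: "p > 0 \<Longrightarrow> inj (\<lambda>u :: int ^ 'n::finite. int p *s u)"
  by (auto simp: inj_def vec_eq_iff)

lemma frobenius_lift_inv_0:
  assumes "unramified_padic_field p a v" "frobenius_lift p v \<phi>"
  shows "inv_into (integer_ring v) \<phi> 0 = 0"
proof -
  interpret unramified_padic_field p a v by fact
  have 0: "0 \<in> integer_ring v"
    using v_eq_0[of 0] by (simp add: integer_ring_def)
  have "\<phi> (0 + 0) = \<phi> 0 + \<phi> 0"
    using assms(2) 0 unfolding frobenius_lift_def ring_hom_on_def by blast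
  hence "\<phi> 0 = 0" by simp
  thus ?thesis
    using assms(2) 0 inv_into_f_f[of \<phi> "integer_ring v" 0]
    by (auto simp: frobenius_lift_def bij_betw_def)
qed

lemma lookup_psi:
  fixes G :: "('n::finite, 'Q::field_char_0) laurent"
  assumes "unramified_padic_field p a v" "frobenius_lift p v \<phi>"
  shows "Poly_Mapping.lookup (psi p v \<phi> G) u =
    inv_into (integer_ring v) \<phi> (Poly_Mapping.lookup G (int p *s u))"
proof -
  interpret unramified_padic_field p a v by fact
  have "finite ((\<lambda>u. int p *s u) -` Poly_Mapping.keys G)"
    using inj_scale prime_gt_0_nat[OF prime_p] by (intro finite_vimageI) auto
  hence "finite {u. int p *s u \<in> Poly_Mapping.keys G}" by (simp add: vimage_def)
  thus ?thesis
    using frobenius_lift_inv_0[OF assms]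
    by (auto simp: psi_def lookup_sum lookup_single when_def in_keys_iff)
qed

lemma integer_ring_closed:
  assumes "padic_valued_field p v"
  shows "0 \<in> integer_ring v" "1 \<in> integer_ring v"
    "x \<in> integer_ring v \<Longrightarrow> y \<in> integer_ring v \<Longrightarrow> x + y \<in> integer_ring v"
    "x \<in> integer_ring v \<Longrightarrow> y \<in> integer_ring v \<Longrightarrow> x * y \<in> integer_ring v"
proof -
  interpret padic_valued_field p v by fact
  show "0 \<in> integer_ring v"
    using v_eq_0[of 0] by (simp add: integer_ring_def)
  have "v 1 = 1" using v_mult[of 1 1] v_eq_0[of 1] by simp
  thus "1 \<in> integer_ring v" by (simp add: integer_ring_def)
  show "x \<in> integer_ring v \<Longrightarrow> y \<in> integer_ring v \<Longrightarrow> x + y \<in> integer_ring v"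
    using v_add[of x y] by (simp add: integer_ring_def)
  show "x \<in> integer_ring v \<Longrightarrow> y \<in> integer_ring v \<Longrightarrow> x * y \<in> integer_ring v"
    using v_nonneg[of x] v_nonneg[of y] by (simp add: integer_ring_def v_mult mult_le_one)
qed

lemma integral_laurent_mult:
  fixes G H :: "('n::finite, 'Q::field_char_0) laurent"
  assumes v: "padic_valued_field p v" and G: "G \<in> integral_laurent v" and H: "H \<in> integral_laurent v"
  shows "G * H \<in> integral_laurent v"
proof -
  note cl = integer_ring_closed[OF v]
  have sum_in: "sum f S \<in> integer_ring v" if "\<And>x. x \<in> S \<Longrightarrow> f x \<in> integer_ring v"
    for f :: "int ^ 'n \<Rightarrow> 'Q" and S
    using that by (induction S rule: infinite_finite_induct) (auto intro: cl)
  have "Poly_Mapping.lookup (G * H) u \<in> integer_ring v" for u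
    unfolding lookup_mult Sum_any.expand_set
    using G H
    by (intro sum_in cl(4)) (auto simp: integral_laurent_def when_def intro!: sum_in cl)
  thus ?thesis by (simp add: integral_laurent_def)
qed

lemma P_module_mult:
  fixes G H :: "('n::finite, 'Q::field_char_0) laurent"
  assumes "padic_valued_field p v" "convex K" "G \<in> P_module v (dilate s K)" "H \<in> P_module v (dilate t K)"
  shows "G * H \<in> P_module v (dilate (s + t) K)"
proof -
  have "real_point u \<in> dilate (s + t) K" if u: "u \<in> Poly_Mapping.keys (G * H)" for u
  proof -
    obtain y z where yz: "u = y + z" "y \<in> Poly_Mapping.keys G" "z \<in> Poly_Mapping.keys H"
      using u keys_mult[of G H] by blast
    obtain k l where k: "k \<in> K" "real_point y = real s *\<^sub>R k"
      and l: "l \<in> K" "real_point z = real t *\<^sub>R l"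
    proof -
      have "real_point y \<in> dilate s K" "real_point z \<in> dilate t K"
        using yz assms(3,4) by (auto simp: P_module_def lattice_points_def)
      thus ?thesis using that by (auto simp: dilate_def)
    qed
    have e: "real_point u = real s *\<^sub>R k + real t *\<^sub>R l"
      unfolding k(2)[symmetric] l(2)[symmetric] yz by (simp add: real_point_def vec_eq_iff)
    show ?thesis
    proof (cases "s + t = 0")
      case True
      thus ?thesis using e k by (auto simp: dilate_def)
    next
      case False
      define w where "w = (real s / real (s + t)) *\<^sub>R k + (real t / real (s + t)) *\<^sub>R l"
      have "w \<in> K" unfolding w_def
        using False k l by (intro convexD[OF assms(2)]) (auto simp: add_divide_distrib[symmetric])
      moreover have "real_point u = real (s + t) *\<^sub>R w"
        using False unfolding e w_def by (simp add: scaleR_add_right del: of_nat_add)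
      ultimately show ?thesis by (auto simp: dilate_def)
    qed
  qed
  thus ?thesis
    using integral_laurent_mult[OF assms(1), of G H] assms(3,4)
    by (auto simp: P_module_def lattice_points_def)
qed

lemma P_module_power:
  fixes H :: "('n::finite, 'Q::field_char_0) laurent"
  assumes v: "padic_valued_field p v" and "convex K" "K \<noteq> {}" "H \<in> P_module v (dilate t K)"
  shows "H ^ m \<in> P_module v (dilate (m * t) K)"
proof (induction m)
  case 0
  have "Poly_Mapping.lookup (1 :: ('n, 'Q) laurent) u \<in> integer_ring v" for u
    using integer_ring_closed(1,2)[OF v] by (simp add: lookup_one when_def)
  moreover have "real_point (0 :: int ^ 'n) \<in> dilate 0 K"
    using \<open>K \<noteq> {}\<close> by (auto simp: dilate_def real_point_def vec_eq_iff)
  ultimately show ?case by (simp add: P_module_def integral_laurent_def lattice_points_def)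
next
  case (Suc m)
  show ?case using P_module_mult[OF v assms(2) assms(4) Suc] by simp
qed

text \<open>The operator \<open>A\<close> restricts to \<open>P_module v K\<close>, so that \<open>P_trace K\<close> of its
  iterates is the trace of an endomorphism of that module.\<close>

lemma A_op_P_module:
  fixes G H :: "('n::finite, 'Q::field_char_0) laurent"
  assumes "unramified_padic_field p a v" "frobenius_lift p v \<phi>"
    and "convex K" and H: "H \<in> P_module v K" and G: "G \<in> P_module v K"
  shows "A_op p v \<phi> H G \<in> P_module v K"
proof (cases "K = {}")
  case True
  hence "G = 0" using G by (auto simp: P_module_def lattice_points_def)
  hence "A_op p v \<phi> H G = 0"
    by (simp add: A_op_def psi_def)
  thus ?thesis using G \<open>G = 0\<close> by simp
next
  case False
  interpret unramified_padic_field p a v by fact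
  have v: "padic_valued_field p v" by unfold_locales
  have p: "p > 0" using prime_p prime_gt_0_nat by blast
  have d1: "dilate (Suc 0) K = K" by (auto simp: dilate_def)
  have "H ^ (p - 1) \<in> P_module v (dilate (p - 1) K)"
    using P_module_power[OF v assms(3) False, of H 1 "p - 1"] H by (simp add: d1)
  hence M: "H ^ (p - 1) * G \<in> P_module v (dilate p K)"
    using P_module_mult[OF v assms(3), of "H ^ (p - 1)" "p - 1" G 1] G p by (simp add: d1)
  have bij: "bij_betw \<phi> (integer_ring v) (integer_ring v)"
    using assms(2) by (simp add: frobenius_lift_def)
  have "Poly_Mapping.lookup (A_op p v \<phi> H G) u \<in> integer_ring v" for u
    using M bij_betw_apply[OF bij_betw_inv_into[OF bij]]
    by (simp add: A_op_def lookup_psi[OF assms(1,2)] P_module_def integral_laurent_def)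
  moreover have "real_point u \<in> K" if "u \<in> Poly_Mapping.keys (A_op p v \<phi> H G)" for u
  proof -
    have "int p *s u \<in> Poly_Mapping.keys (H ^ (p - 1) * G)"
      using that frobenius_lift_inv_0[OF assms(1,2)]
      by (auto simp: A_op_def in_keys_iff lookup_psi[OF assms(1,2)])
    then obtain k where k: "k \<in> K" "real_point (int p *s u) = real p *\<^sub>R k"
    proof -
      assume u: "int p *s u \<in> Poly_Mapping.keys (H ^ (p - 1) * G)"
      have "real_point (int p *s u) \<in> dilate p K"
        using M u by (auto simp: P_module_def lattice_points_def)
      thus ?thesis using that by (auto simp: dilate_def)
    qed
    have "real_point u = k"
      using k(2) p by (simp add: real_point_def vec_eq_iff)
    thus ?thesis using k by simp
  qed
  ultimately show ?thesis
    by (auto simp: P_module_def integral_laurent_def lattice_points_def)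
qed

end

theory Submission
  imports Defs "HOL-Algebra.Multiplicative_Group"
begin

text \<open>
  Put \<open>m = a r\<close>, \<open>Q = p^m = q^r\<close>, \<open>N = Q - 1\<close>, and \<open>g = \<Prod>\<^bsub>i<m\<^esub> \<phi>\<^sup>i(F)\<^bsup>p-1\<^esup>\<close>. Moving \<open>\<psi>\<close> past
  multiplications and using that \<open>\<phi>\<^sup>a\<close> is the identity on \<open>\<int>\<^sub>q\<close>, the trace of \<open>A\<^sup>m\<close> for \<open>F\<^sup>s\<close> is the sum of the
  coefficients of \<open>g\<^sup>s\<close> at the exponents in \<open>N \<int>\<^sup>n\<close>; times \<open>N\<^sup>n\<close> this is the sum of \<open>g(c)\<^sup>s\<close>
  over all points \<open>c\<close> with coordinates \<open>N\<close>-th roots of unity. The generating polynomial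
  \<open>\<Sum>\<^sub>s \<alpha>\<^sub>s y\<^sup>s\<close> equals \<open>(1 - y)\<^sup>\<lambda>\<close> times the truncation at \<open>y\<^sup>\<tau>\<close> of the series of \<open>(1 - y)\<^bsup>-\<lambda>\<^esup>\<close>, so it is
  \<open>0\<close> modulo \<open>p\<^sup>\<lambda>\<close> when \<open>y \<equiv> 1 (mod p)\<close>, and \<open>1\<close> modulo \<open>p\<^sup>\<lambda>\<close> when \<open>p^(m (p - 1))\<close> divides \<open>y\<close>
  (as \<open>\<tau> m (p - 1) \<ge> \<lambda>\<close>). These are
  the two cases for \<open>y = g(c)\<close>, according to whether the reduction of \<open>c\<close> lies off or on \<open>V\<close>.

  The roots of unity live in an unramified extension of \<open>\<rat>\<^sub>q\<close>, which is never constructed: with \<open>\<gamma>\<close> a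
  generator of the multiplicative group of the field with \<open>Q\<close> elements, one computes in
  \<open>\<int>\<^sub>q[t\<^sup>\<plusminus>]\<close> modulo \<open>t\<^sup>N - 1\<close>, localised at the kernel of the map \<open>t \<mapsto> \<gamma>\<close>.
\<close>

section \<open>Congruences in subrings\<close>

text \<open>A set rather than a type: the rings in play are the valuation ring inside the field
  \<open>'Q\<close> and Laurent polynomials with coefficients in it.\<close>

locale subring_set =
  fixes S :: "'a::comm_ring_1 set"
  assumes one_closed [simp, intro]: "1 \<in> S"
    and diff_closed [intro]: "x \<in> S \<Longrightarrow> y \<in> S \<Longrightarrow> x - y \<in> S"
    and mult_closed [intro]: "x \<in> S \<Longrightarrow> y \<in> S \<Longrightarrow> x * y \<in> S"
begin

lemma zero_closed [simp, intro]: "0 \<in> S"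
  using diff_closed[of 1 1] by simp

lemma uminus_closed [intro]: "x \<in> S \<Longrightarrow> - x \<in> S"
  using diff_closed[of 0 x] by simp

lemma add_closed [intro]: "x \<in> S \<Longrightarrow> y \<in> S \<Longrightarrow> x + y \<in> S"
  using diff_closed[of x "- y"] uminus_closed by simp

lemma sum_closed [intro]: "(\<And>i. i \<in> A \<Longrightarrow> f i \<in> S) \<Longrightarrow> sum f A \<in> S"
  by (induction A rule: infinite_finite_induct) auto

lemma prod_closed [intro]: "(\<And>i. i \<in> A \<Longrightarrow> f i \<in> S) \<Longrightarrow> prod f A \<in> S"
  by (induction A rule: infinite_finite_induct) auto

lemma power_closed [intro]: "x \<in> S \<Longrightarrow> x ^ n \<in> S"
  by (induction n) auto

lemma of_nat_closed [simp, intro]: "of_nat n \<in> S"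
  by (induction n) auto

lemma of_int_closed [simp, intro]: "of_int n \<in> S"
  by (cases n rule: int_cases2) auto

end

text \<open>The quotient has to lie in \<open>S\<close>: in the field \<open>'Q\<close>, where
  \<open>p\<close> is invertible, divisibility would otherwise say nothing.\<close>

definition cong_in :: "'a::comm_ring_1 set \<Rightarrow> 'a \<Rightarrow> 'a \<Rightarrow> 'a \<Rightarrow> bool" where
  "cong_in S d x y \<longleftrightarrow> (\<exists>z\<in>S. x - y = d * z)"

context subring_set
begin

lemma cong_refl [simp]: "cong_in S d x x"
  by (auto simp: cong_in_def intro!: bexI[of _ 0])

lemma cong_sym: "cong_in S d x y \<Longrightarrow> cong_in S d y x"
  unfolding cong_in_def by (metis minus_diff_eq mult_minus_right uminus_closed)

lemma cong_add: "cong_in S d x y \<Longrightarrow> cong_in S d x' y' \<Longrightarrow> cong_in S d (x + x') (y + y')"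
  unfolding cong_in_def by (metis add_closed add_diff_add distrib_left)

lemma cong_trans: "cong_in S d x y \<Longrightarrow> cong_in S d y z \<Longrightarrow> cong_in S d x z"
  using cong_add[of d x y y z] by (simp add: cong_in_def algebra_simps)

lemma cong_mult:
  assumes "cong_in S d x y" "cong_in S d x' y'" "x' \<in> S" "y \<in> S"
  shows "cong_in S d (x * x') (y * y')"
proof -
  obtain z z' where z: "z \<in> S" "x - y = d * z" and z': "z' \<in> S" "x' - y' = d * z'"
    using assms by (auto simp: cong_in_def)
  have "x * x' - y * y' = (x - y) * x' + y * (x' - y')" by (simp add: algebra_simps)
  also have "\<dots> = d * (z * x' + y * z')" by (simp add: z z' algebra_simps)
  finally show ?thesis using z z' assms by (auto simp: cong_in_def)
qed

lemma cong_power: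
  "cong_in S d x y \<Longrightarrow> x \<in> S \<Longrightarrow> y \<in> S \<Longrightarrow> cong_in S d (x ^ n) (y ^ n)"
  by (induction n) (auto intro: cong_mult)

lemma cong_sum:
  "(\<And>i. i \<in> A \<Longrightarrow> cong_in S d (f i) (g i)) \<Longrightarrow> cong_in S d (sum f A) (sum g A)"
  by (induction A rule: infinite_finite_induct) (auto intro: cong_add)

section \<open>Congruences between \<open>p\<close>-th powers\<close>

lemma freshman_dream:
  assumes p: "prime p" and "x \<in> S" "y \<in> S"
  shows "cong_in S (of_nat p) ((x + y) ^ p) (x ^ p + y ^ p)"
proof -
  have p0: "0 < p" using prime_gt_0_nat[OF p] .
  have "cong_in S (of_nat p) (\<Sum>k\<in>{0<..<p}. of_nat (p choose k) * x ^ k * y ^ (p - k)) (\<Sum>k\<in>{0<..<p}. 0)"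
  proof (rule cong_sum)
    fix k assume k: "k \<in> {0<..<p}"
    then obtain c where c: "p choose k = p * c"
      using dvd_choose_prime[of k p] p by (auto elim: dvdE)
    show "cong_in S (of_nat p) (of_nat (p choose k) * x ^ k * y ^ (p - k)) 0"
      unfolding cong_in_def c
      using assms by (intro bexI[of _ "of_nat c * x ^ k * y ^ (p - k)"]) (auto simp: mult.assoc)
  qed
  moreover have "(x + y) ^ p = x ^ p + y ^ p + (\<Sum>k\<in>{0<..<p}. of_nat (p choose k) * x ^ k * y ^ (p - k))"
  proof -
    have "{..p} = insert 0 (insert p {0<..<p})" using p0 by auto
    then show ?thesis using p0 by (simp add: binomial_ring)
  qed
  ultimately show ?thesis by (simp add: cong_in_def)
qed

lemma freshman_dream_sum:
  assumes "prime p" "\<And>i. i \<in> A \<Longrightarrow> f i \<in> S"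
  shows "cong_in S (of_nat p) ((\<Sum>i\<in>A. f i) ^ p) (\<Sum>i\<in>A. f i ^ p)"
  using assms(2)
proof (induction A rule: infinite_finite_induct)
  case (insert i A)
  have "cong_in S (of_nat p) ((f i + sum f A) ^ p) (f i ^ p + sum f A ^ p)"
    using insert.prems by (intro freshman_dream assms(1)) auto
  moreover have "cong_in S (of_nat p) (f i ^ p + sum f A ^ p) (f i ^ p + (\<Sum>i\<in>A. f i ^ p))"
    using insert by (intro cong_add) auto
  ultimately show ?case using insert.hyps by (auto intro: cong_trans)
qed (use prime_gt_0_nat[OF assms(1)] in \<open>auto simp: power_0_left\<close>)

lemma freshman_dream_sum_iterated:
  assumes p: "prime p" and f: "\<And>i. i \<in> A \<Longrightarrow> f i \<in> S"
  shows "cong_in S (of_nat p) ((\<Sum>i\<in>A. f i) ^ (p ^ k)) (\<Sum>i\<in>A. f i ^ (p ^ k))"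
proof (induction k)
  case (Suc k)
  have "cong_in S (of_nat p) (((\<Sum>i\<in>A. f i) ^ (p ^ k)) ^ p) ((\<Sum>i\<in>A. f i ^ (p ^ k)) ^ p)"
    using f by (intro cong_power Suc) auto
  moreover have "cong_in S (of_nat p) ((\<Sum>i\<in>A. f i ^ (p ^ k)) ^ p) (\<Sum>i\<in>A. (f i ^ (p ^ k)) ^ p)"
    using f by (intro freshman_dream_sum p) auto
  ultimately show ?case
    by (auto simp: power_mult[symmetric] mult.commute intro: cong_trans)
qed auto

text \<open>\<open>x ^ p - y ^ p\<close> is \<open>x - y\<close> times a sum of \<open>p\<close>
  terms, each congruent to \<open>y ^ (p - 1)\<close> modulo \<open>p\<close>; that sum supplies the
  additional factor \<open>p\<close>.\<close>

lemma cong_power_prime_lift: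
  assumes c: "cong_in S (of_nat p ^ Suc k) x y" and "x \<in> S" "y \<in> S"
  shows "cong_in S (of_nat p ^ Suc (Suc k)) (x ^ p) (y ^ p)"
proof -
  obtain z where z: "z \<in> S" "x - y = of_nat p ^ Suc k * z"
    using c by (auto simp: cong_in_def)
  have "cong_in S (of_nat p) x y"
    unfolding cong_in_def using z by (intro bexI[of _ "of_nat p ^ k * z"]) (auto simp: mult_ac)
  then have "cong_in S (of_nat p) (\<Sum>i<p. y ^ (p - Suc i) * x ^ i) (\<Sum>i<p. y ^ (p - Suc i) * y ^ i)"
    using assms by (intro cong_sum cong_mult cong_power) auto
  also have "(\<Sum>i<p. y ^ (p - Suc i) * y ^ i) = (\<Sum>i<p. y ^ (p - 1))"
    by (intro sum.cong) (auto simp: power_add[symmetric])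
  finally obtain w where w: "w \<in> S" "(\<Sum>i<p. y ^ (p - Suc i) * x ^ i) - of_nat p * y ^ (p - 1) = of_nat p * w"
    by (auto simp: cong_in_def)
  have "x ^ p - y ^ p = (x - y) * (\<Sum>i<p. y ^ (p - Suc i) * x ^ i)"
    by (rule power_diff_sumr2)
  also have "(\<Sum>i<p. y ^ (p - Suc i) * x ^ i) = of_nat p * (w + y ^ (p - 1))"
    using w(2) by (simp add: algebra_simps)
  finally have "x ^ p - y ^ p = of_nat p ^ Suc (Suc k) * (z * (w + y ^ (p - 1)))"
    by (simp add: z mult_ac)
  then show ?thesis unfolding cong_in_def using z w assms by blast
qed

text \<open>The product is \<open>1\<close> modulo \<open>y ^ \<tau>\<close> because the second factor truncates the power series
  of \<open>(1 - y) ^ -l\<close>.\<close>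

lemma truncated_neg_binomial:
  assumes y: "y \<in> S" and "\<tau> > 0"
  shows "\<exists>R\<in>S. (1 - y) ^ l * (\<Sum>t<\<tau>. of_nat ((l + t - 1) choose t) * y ^ t) = 1 + y ^ \<tau> * R"
proof (induction l)
  case 0
  \<comment> \<open>For \<open>l = 0\<close> only \<open>t = 0\<close> contributes, where truncated
    subtraction gives \<open>0 choose 0\<close>; \<open>\<tau> > 0\<close> keeps this term in
    range.\<close>
  have "(\<Sum>t<\<tau>. of_nat ((0 + t - 1) choose t) * y ^ t) = (\<Sum>t<\<tau>. if t = 0 then 1 else 0)"
    by (intro sum.cong) (auto simp: binomial_eq_0)
  then show ?case using assms by (auto intro!: bexI[of _ 0])
next
  case (Suc l)
  then obtain R where R: "R \<in> S" 
    "(1 - y) ^ l * (\<Sum>t<\<tau>. of_nat ((l + t - 1) choose t) * y ^ t) = 1 + y ^ \<tau> * R" by auto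
  \<comment> \<open>Multiplying by \<open>1 - y\<close> lowers \<open>Suc l\<close> to
    \<open>l\<close> by Pascal's rule, and \<open>c n * y ^ n\<close> is what truncation at
    \<open>n\<close> leaves over. At \<open>n = \<tau>\<close> this is a multiple of
    \<open>y ^ \<tau>\<close> and goes into \<open>R\<close>.\<close>
  define c where "c n = (of_nat ((l + n - 1) choose (n - 1)) :: 'a)" for n
  have step: "(1 - y) * (\<Sum>t<n. of_nat ((Suc l + t - 1) choose t) * y ^ t) =
      (\<Sum>t<n. of_nat ((l + t - 1) choose t) * y ^ t) - (if n = 0 then 0 else c n * y ^ n)" for n
  proof (induction n)
    case (Suc n)
    show ?case
    proof (cases n)
      case (Suc k)
      have "(l + n) choose n = ((l + n - 1) choose (n - 1)) + ((l + n - 1) choose n)"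
        using Suc by (simp add: binomial_Suc_Suc)
      then have C: "(of_nat ((l + n) choose n) :: 'a) = c n + of_nat ((l + n - 1) choose n)"
        by (simp add: c_def)
      have "(1 - y) * (\<Sum>t<Suc n. of_nat ((Suc l + t - 1) choose t) * y ^ t) =
          (1 - y) * (\<Sum>t<n. of_nat ((Suc l + t - 1) choose t) * y ^ t) +
            of_nat ((l + n) choose n) * y ^ n - of_nat ((l + n) choose n) * y ^ Suc n"
        by (simp add: ring_distribs mult_ac)
      also have "\<dots> = (\<Sum>t<n. of_nat ((l + t - 1) choose t) * y ^ t) +
          of_nat ((l + n - 1) choose n) * y ^ n - of_nat ((l + n) choose n) * y ^ Suc n"
        unfolding Suc.IH using Suc by (simp add: C ring_distribs c_def)
      finally show ?thesis by (simp add: c_def)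
    qed (simp add: c_def)
  qed simp
  have "(1 - y) ^ Suc l * (\<Sum>t<\<tau>. of_nat ((Suc l + t - 1) choose t) * y ^ t) =
      (1 - y) ^ l * ((1 - y) * (\<Sum>t<\<tau>. of_nat ((Suc l + t - 1) choose t) * y ^ t))"
    by (simp add: mult_ac)
  also have "\<dots> = 1 + y ^ \<tau> * (R - (1 - y) ^ l * c \<tau>)"
    unfolding step using \<open>\<tau> > 0\<close> R(2) by (simp add: algebra_simps)
  finally show ?case
    by (rule bexI) (unfold c_def, intro diff_closed mult_closed power_closed one_closed of_nat_closed R y)
qed

end

section \<open>Group algebras and their evaluations\<close>

definition coeffs_in :: "'b::zero set \<Rightarrow> ('a \<Rightarrow>\<^sub>0 'b) set" where
  "coeffs_in R = {G. \<forall>u. Poly_Mapping.lookup G u \<in> R}"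

lemma poly_mapping_sum_single:
  fixes G :: "'a \<Rightarrow>\<^sub>0 'b::comm_monoid_add"
  assumes "finite U" "Poly_Mapping.keys G \<subseteq> U"
  shows "G = (\<Sum>u\<in>U. Poly_Mapping.single u (Poly_Mapping.lookup G u))"
proof (rule poly_mapping_eqI)
  fix w
  have "Poly_Mapping.lookup (\<Sum>u\<in>U. Poly_Mapping.single u (Poly_Mapping.lookup G u)) w =
      (\<Sum>u\<in>U. if u = w then Poly_Mapping.lookup G u else 0)"
    by (auto simp: lookup_sum lookup_single when_def intro!: sum.cong)
  also have "\<dots> = Poly_Mapping.lookup G w"
    using assms by (auto simp: in_keys_iff)
  finally show "Poly_Mapping.lookup G w =
      Poly_Mapping.lookup (\<Sum>u\<in>U. Poly_Mapping.single u (Poly_Mapping.lookup G u)) w" by simp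
qed

lemma single_power:
  fixes c :: "'b::comm_ring_1"
  shows "Poly_Mapping.single u c ^ n = Poly_Mapping.single ((\<Sum>i<n. u)) (c ^ n)"
  by (induction n) (auto simp: mult_single add.commute)

lemma lookup_single_mult:
  fixes G :: "'a::ab_group_add \<Rightarrow>\<^sub>0 'b::comm_ring_1"
  shows "Poly_Mapping.lookup (Poly_Mapping.single u c * G) w = c * Poly_Mapping.lookup G (w - u)"
proof -
  have "Poly_Mapping.single u c * G =
      (\<Sum>k\<in>Poly_Mapping.keys G. Poly_Mapping.single (u + k) (c * Poly_Mapping.lookup G k))"
    by (subst (1) poly_mapping_sum_single[of "Poly_Mapping.keys G" G])
      (auto simp: sum_distrib_left mult_single)
  then have "Poly_Mapping.lookup (Poly_Mapping.single u c * G) w =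
      (\<Sum>k\<in>Poly_Mapping.keys G. if k = w - u then c * Poly_Mapping.lookup G k else 0)"
    by (auto simp: lookup_sum lookup_single when_def algebra_simps intro!: sum.cong)
  then show ?thesis by (auto simp: in_keys_iff)
qed

lemma lookup_mult_eq_sum:
  fixes G H :: "'a::ab_group_add \<Rightarrow>\<^sub>0 'b::comm_ring_1"
  assumes "finite U" "Poly_Mapping.keys G \<subseteq> U"
  shows "Poly_Mapping.lookup (G * H) w =
    (\<Sum>u\<in>U. Poly_Mapping.lookup G u * Poly_Mapping.lookup H (w - u))"
  by (subst (1) poly_mapping_sum_single[OF assms])
    (simp add: sum_distrib_right lookup_sum lookup_single_mult)

lemma subring_set_coeffs_in:
  fixes R :: "'b::comm_ring_1 set"
  assumes "subring_set R"
  shows "subring_set (coeffs_in R :: ('a::ab_group_add \<Rightarrow>\<^sub>0 'b) set)"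
proof -
  interpret subring_set R by fact
  show ?thesis
  proof
    fix x y :: "'a \<Rightarrow>\<^sub>0 'b" assume xy: "x \<in> coeffs_in R" "y \<in> coeffs_in R"
    then show "x * y \<in> coeffs_in R"
      by (auto simp: coeffs_in_def lookup_mult_eq_sum[OF finite_keys subset_refl, of x])
  qed (auto simp: coeffs_in_def lookup_one lookup_minus when_def)
qed

lemma single_in_coeffs_in: "0 \<in> R \<Longrightarrow> c \<in> R \<Longrightarrow> Poly_Mapping.single u c \<in> coeffs_in R"
  by (auto simp: coeffs_in_def lookup_single when_def)

text \<open>One construction serves for \<open>Frob\<close>, for the evaluations \<open>e\<close>
  and \<open>ev\<close>, and, with a \<open>ch\<close> that is not multiplicative, for the class
  sums in \<open>constant_in_I\<close>.\<close>

definition pm_eval :: "('b::zero \<Rightarrow> 'c::comm_ring_1) \<Rightarrow> ('a \<Rightarrow> 'c) \<Rightarrow> ('a \<Rightarrow>\<^sub>0 'b) \<Rightarrow> 'c" where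
  "pm_eval f ch G = (\<Sum>u\<in>Poly_Mapping.keys G. f (Poly_Mapping.lookup G u) * ch u)"

text \<open>Homomorphy is demanded on \<open>R\<close> alone, since maps such as \<open>red\<close>
  and \<open>\<phi>\<close> are meaningful only on the valuation ring.\<close>

locale coeff_hom = subring_set R for R :: "'b::comm_ring_1 set" +
  fixes f :: "'b \<Rightarrow> 'c::comm_ring_1"
  assumes hom: "ring_hom_on R f"
begin

lemma hom_1: "f 1 = 1"
  and hom_add: "x \<in> R \<Longrightarrow> y \<in> R \<Longrightarrow> f (x + y) = f x + f y"
  and hom_mult: "x \<in> R \<Longrightarrow> y \<in> R \<Longrightarrow> f (x * y) = f x * f y"
  using hom by (auto simp: ring_hom_on_def)

lemma hom_0: "f 0 = 0"
  using hom_add[of 0 0] by simp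

lemma hom_diff: "x \<in> R \<Longrightarrow> y \<in> R \<Longrightarrow> f (x - y) = f x - f y"
  using hom_add[of "x - y" y] diff_closed by auto

lemma hom_power: "x \<in> R \<Longrightarrow> f (x ^ n) = f x ^ n"
  by (induction n) (auto simp: hom_1 hom_mult power_closed)

lemma hom_sum: "(\<And>i. i \<in> A \<Longrightarrow> g i \<in> R) \<Longrightarrow> f (sum g A) = (\<Sum>i\<in>A. f (g i))"
  by (induction A rule: infinite_finite_induct) (auto simp: hom_0 hom_add sum_closed)

lemma hom_prod: "(\<And>i. i \<in> A \<Longrightarrow> g i \<in> R) \<Longrightarrow> f (prod g A) = (\<Prod>i\<in>A. f (g i))"
  by (induction A rule: infinite_finite_induct) (auto simp: hom_1 hom_mult prod_closed)

lemma hom_of_nat: "f (of_nat n) = of_nat n"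
  by (induction n) (auto simp: hom_0 hom_1 hom_add)

lemma pm_eval_eq_sum:
  assumes "finite U" "Poly_Mapping.keys G \<subseteq> U"
  shows "pm_eval f ch G = (\<Sum>u\<in>U. f (Poly_Mapping.lookup G u) * ch u)"
  unfolding pm_eval_def
  using assms by (intro sum.mono_neutral_left) (auto simp: in_keys_iff hom_0)

lemma pm_eval_single: "pm_eval f ch (Poly_Mapping.single u c) = f c * ch u"
  by (subst pm_eval_eq_sum[of "{u}"]) auto

lemma pm_eval_add:
  assumes "G \<in> coeffs_in R" "H \<in> coeffs_in R"
  shows "pm_eval f ch (G + H) = pm_eval f ch G + pm_eval f ch H"
proof -
  define U where "U = Poly_Mapping.keys G \<union> Poly_Mapping.keys H"
  have U: "finite U" "Poly_Mapping.keys G \<subseteq> U" "Poly_Mapping.keys H \<subseteq> U"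
    "Poly_Mapping.keys (G + H) \<subseteq> U"
    using Poly_Mapping.keys_add[of G H] by (auto simp: U_def)
  show ?thesis
    using U assms by (simp add: pm_eval_eq_sum[of U] lookup_add coeffs_in_def hom_add
        distrib_right sum.distrib)
qed

lemma pm_eval_single_mult:
  fixes G :: "'a::ab_group_add \<Rightarrow>\<^sub>0 'b"
  assumes "c \<in> R" "G \<in> coeffs_in R"
  shows "pm_eval f ch (Poly_Mapping.single k c * G) = f c * pm_eval f (\<lambda>u. ch (k + u)) G"
proof -
  have keys: "Poly_Mapping.keys (Poly_Mapping.single k c * G) \<subseteq> (+) k ` Poly_Mapping.keys G"
  proof
    fix u assume "u \<in> Poly_Mapping.keys (Poly_Mapping.single k c * G)"
    then have "u - k \<in> Poly_Mapping.keys G" by (auto simp: in_keys_iff lookup_single_mult)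
    then show "u \<in> (+) k ` Poly_Mapping.keys G" by (rule rev_image_eqI) simp
  qed
  show ?thesis
    using assms
    by (subst pm_eval_eq_sum[OF _ keys])
      (auto simp: sum.reindex lookup_single_mult pm_eval_def sum_distrib_left hom_mult coeffs_in_def
        mult.assoc intro!: sum.cong)
qed

lemma pm_eval_ring_hom:
  fixes ch :: "'a::ab_group_add \<Rightarrow> 'c"
  assumes ch: "\<And>u w. ch (u + w) = ch u * ch w" "ch 0 = 1"
  shows "coeff_hom (coeffs_in R) (pm_eval f ch)"
proof -
  interpret C: subring_set "coeffs_in R :: ('a \<Rightarrow>\<^sub>0 'b) set"
    by (rule subring_set_coeffs_in) unfold_locales
  have s: "pm_eval f ch (sum g A) = (\<Sum>i\<in>A. pm_eval f ch (g i))"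
    if "\<And>i. i \<in> A \<Longrightarrow> g i \<in> coeffs_in R" for A :: "'a set" and g :: "'a \<Rightarrow> 'a \<Rightarrow>\<^sub>0 'b"
    using that
    by (induction A rule: infinite_finite_induct) (auto simp: pm_eval_add C.sum_closed, auto simp: pm_eval_def)
  have m: "pm_eval f ch (G * H) = pm_eval f ch G * pm_eval f ch H"
    if G: "G \<in> coeffs_in R" and H: "H \<in> coeffs_in R" for G H :: "'a \<Rightarrow>\<^sub>0 'b"
  proof -
    have in_R: "Poly_Mapping.lookup G u \<in> R" "Poly_Mapping.lookup H u \<in> R" for u
      using G H by (auto simp: coeffs_in_def)
    have "G * H = (\<Sum>u\<in>Poly_Mapping.keys G. \<Sum>w\<in>Poly_Mapping.keys H.
        Poly_Mapping.single (u + w) (Poly_Mapping.lookup G u * Poly_Mapping.lookup H w))"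
      by (subst (1) poly_mapping_sum_single[of _ G, OF finite_keys subset_refl],
          subst (1) poly_mapping_sum_single[of _ H, OF finite_keys subset_refl])
        (simp add: sum_product mult_single)
    then have "pm_eval f ch (G * H) = (\<Sum>u\<in>Poly_Mapping.keys G. \<Sum>w\<in>Poly_Mapping.keys H.
        pm_eval f ch (Poly_Mapping.single (u + w) (Poly_Mapping.lookup G u * Poly_Mapping.lookup H w)))"
      by (simp add: s in_R C.sum_closed single_in_coeffs_in mult_closed)
    also have "\<dots> = (\<Sum>u\<in>Poly_Mapping.keys G. \<Sum>w\<in>Poly_Mapping.keys H.
        (f (Poly_Mapping.lookup G u) * ch u) * (f (Poly_Mapping.lookup H w) * ch w))"
      by (intro sum.cong) (auto simp: pm_eval_single hom_mult in_R ch mult_ac)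
    finally show ?thesis by (simp add: pm_eval_def sum_product)
  qed
  have "pm_eval f ch 1 = 1"
    using pm_eval_single[of ch 0 1] by (simp add: hom_1 ch)
  then show ?thesis
    by unfold_locales (auto simp: ring_hom_on_def pm_eval_add m)
qed

end

lemma ring_hom_on_single_0: "ring_hom_on R (Poly_Mapping.single 0)"
  by (auto simp: ring_hom_on_def single_add mult_single)

section \<open>Finite fields, lattice points and the coefficients \<open>\<alpha>\<^sub>s\<close>\<close>

text \<open>Multiplication by \<open>x\<close> permutes the non-zero elements, so their product
  \<open>P\<close> satisfies \<open>P = x ^ (CARD('a) - 1) * P\<close>, and \<open>P\<close> is
  non-zero.\<close>

lemma finite_field_power_card_minus_1:
  fixes x :: "'a::field"
  assumes fin: "finite (UNIV :: 'a set)" and x: "x \<noteq> 0"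
  shows "x ^ (CARD('a) - 1) = 1"
proof -
  define P where "P = (\<Prod>y\<in>UNIV - {0 :: 'a}. y)"
  have "bij_betw ((*) x) (UNIV - {0}) (UNIV - {0})"
    using x by (intro bij_betwI[where g = "(*) (inverse x)"]) auto
  then have "P = (\<Prod>y\<in>UNIV - {0}. x * y)"
    unfolding P_def by (rule prod.reindex_bij_betw[symmetric])
  also have "\<dots> = x ^ (CARD('a) - 1) * P"
    using fin by (simp add: prod.distrib P_def card_Diff_singleton)
  finally show ?thesis using fin by (auto simp: P_def)
qed

lemma finite_field_power_card:
  fixes x :: "'a::field"
  assumes fin: "finite (UNIV :: 'a set)"
  shows "x ^ CARD('a) = x"
proof (cases "x = 0")
  case False
  have "CARD('a) = Suc (CARD('a) - 1)" using finite_UNIV_card_ge_0[OF fin] by simp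
  then show ?thesis
    using finite_field_power_card_minus_1[OF fin False] by (metis mult.right_neutral power_Suc)
qed (use finite_UNIV_card_ge_0[OF fin] in auto)

text \<open>The type-class field is repackaged as a record of \<open>HOL-Algebra\<close>, where the
  multiplicative group of a finite field is known to be cyclic.\<close>

lemma finite_field_has_generator:
  assumes "finite (UNIV :: 'a::field set)"
  shows "\<exists>x::'a. x \<noteq> 0 \<and> (\<forall>y. y \<noteq> 0 \<longrightarrow> (\<exists>i::nat. y = x ^ i))"
proof -
  define R :: "'a ring" where
    "R = \<lparr>carrier = UNIV, monoid.mult = (*), one = 1, zero = 0, add = (+)\<rparr>"
  have "\<exists>y::'a. y + x = 0" for x by (rule exI[of _ "- x"]) simp
  then interpret R: cring R
    by (intro cringI abelian_groupI comm_monoidI) (simp_all add: R_def algebra_simps)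
  interpret R: field R
    by (rule R.cring_fieldI2) (auto simp: R_def intro: right_inverse)
  have pow: "x [^]\<^bsub>R\<^esub> i = x ^ i" for x and i :: nat
    by (induction i) (auto simp: R_def nat_pow_def)
  have "finite (carrier R)" using assms by (simp add: R_def)
  from R.finite_field_mult_group_has_gen[OF this]
  obtain x where x: "x \<in> carrier (mult_of R)" "carrier (mult_of R) = {x [^]\<^bsub>R\<^esub> i | i::nat. i \<in> UNIV}"
    by blast
  have c: "carrier (mult_of R) = UNIV - {0}" by (simp add: R_def)
  have "x \<noteq> 0" using x(1) unfolding c by simp
  moreover have "\<exists>i::nat. y = x ^ i" if "y \<noteq> 0" for y
  proof -
    have "y \<in> carrier (mult_of R)" using that unfolding c by simp
    then show ?thesis unfolding x(2) pow by blast
  qed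
  ultimately show ?thesis by blast
qed

lemma coeff_hom_funpow:
  assumes "coeff_hom R g" "g \<in> R \<rightarrow> R"
  shows "coeff_hom R (g ^^ i)" "x \<in> R \<Longrightarrow> (g ^^ i) x \<in> R"
proof -
  interpret g: coeff_hom R g by fact
  show in_R: "(g ^^ i) x \<in> R" if "x \<in> R" for x i
    using assms(2) that by (induction i) auto
  show "coeff_hom R (g ^^ i)"
  proof (induction i)
    case (Suc i)
    interpret h: coeff_hom R "g ^^ i" by fact
    show ?case
      by unfold_locales (auto simp: ring_hom_on_def h.hom_1 h.hom_add h.hom_mult g.hom_1 g.hom_add g.hom_mult in_R)
  qed (unfold_locales, auto simp: ring_hom_on_def)
qed

lemma convex_dilate: "convex K \<Longrightarrow> convex (dilate s K)"
  by (simp add: dilate_def convex_scaling)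

lemma finite_lattice_points:
  fixes K :: "(real ^ 'n::finite) set"
  assumes "bounded K"
  shows "finite (lattice_points K)"
proof -
  obtain B where B: "\<And>x. x \<in> K \<Longrightarrow> norm x \<le> B"
    using assms by (auto simp: bounded_iff)
  have "u $ i \<in> {- \<lceil>B\<rceil>..\<lceil>B\<rceil>}" if "u \<in> lattice_points K" for u i
  proof -
    from that have "\<bar>real_of_int (u $ i)\<bar> \<le> B"
      using B[of "real_point u"] component_le_norm_cart[of "real_point u" i]
      by (auto simp: lattice_points_def real_point_def)
    then show ?thesis by auto linarith+
  qed
  then have "vec_nth ` lattice_points K \<subseteq> UNIV \<rightarrow>\<^sub>E {- \<lceil>B\<rceil>..\<lceil>B\<rceil>}" by auto
  then have "finite (vec_nth ` lattice_points K)"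
    by (rule finite_subset) (auto intro: finite_PiE)
  then show ?thesis
    by (rule finite_imageD) (auto simp: inj_on_def vec_nth_inject)
qed

text \<open>The integer behind \<open>alpha\<close>: for \<open>l > 0\<close> the generalized
  binomial with upper entry \<open>-l\<close> is \<open>(-1) ^ t * ((l + t - 1) choose t)\<close>.
  As an integer it can be mapped into every ring, in particular into one-variable Laurent
  polynomials.\<close>

definition alpha_int :: "nat \<Rightarrow> nat \<Rightarrow> nat \<Rightarrow> int" where
  "alpha_int l \<tau> s = (\<Sum>t<\<tau>. (-1) ^ (s + t) * int ((l + t - 1) choose t) *
     (if t \<le> s then int (l choose (s - t)) else 0))"

lemma alpha_eq_alpha_int:
  assumes "l > 0"
  shows "alpha l \<tau> s = of_int (alpha_int l \<tau> s)"
proof -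
  have "(- of_nat l :: rat) gchoose t = (-1) ^ t * of_nat ((l + t - 1) choose t)" for t
  proof -
    have "(of_nat l + of_nat t - 1 :: rat) = of_nat (l + t - 1)" using assms by simp
    then show ?thesis by (simp only: gbinomial_minus binomial_gbinomial)
  qed
  then show ?thesis
    by (auto simp: alpha_def alpha_int_def sum_distrib_left power_add intro!: sum.cong)
qed

text \<open>A Cauchy product: the double sum splits along \<open>s = t + j\<close>, and the factor
  in \<open>j\<close> is the binomial expansion of \<open>(1 - y) ^ l\<close>.\<close>

lemma alpha_int_generating:
  fixes y :: "'a::comm_ring_1"
  assumes "l > 0"
  shows "(\<Sum>s = 0..l + \<tau> - 1. of_int (alpha_int l \<tau> s) * y ^ s) =
    (1 - y) ^ l * (\<Sum>t<\<tau>. of_nat ((l + t - 1) choose t) * y ^ t)"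
proof -
  define A where "A t = (of_nat ((l + t - 1) choose t) :: 'a)" for t
  define B where "B j = (of_nat (l choose j) :: 'a)" for j
  have inner: "(\<Sum>s = 0..l + \<tau> - 1. (if t \<le> s then (-1) ^ (s + t) * A t * B (s - t) * y ^ s else 0)) =
      (1 - y) ^ l * (A t * y ^ t)" if "t < \<tau>" for t
  proof -
    \<comment> \<open>For fixed \<open>t < \<tau>\<close> all \<open>s = t + j\<close> with
      \<open>j \<le> l\<close> lie below \<open>l + \<tau>\<close>; for the other \<open>s\<close>
      the summand vanishes.\<close>
    have "(\<Sum>s = 0..l + \<tau> - 1. (if t \<le> s then (-1) ^ (s + t) * A t * B (s - t) * y ^ s else 0)) =
        (\<Sum>s\<in>(+) t ` {..l}. (if t \<le> s then (-1) ^ (s + t) * A t * B (s - t) * y ^ s else 0))"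
    proof (rule sum.mono_neutral_right)
      show "(+) t ` {..l} \<subseteq> {0..l + \<tau> - 1}" using that by auto
      show "\<forall>s\<in>{0..l + \<tau> - 1} - (+) t ` {..l}.
          (if t \<le> s then (-1) ^ (s + t) * A t * B (s - t) * y ^ s else 0) = 0"
      proof
        fix s assume s: "s \<in> {0..l + \<tau> - 1} - (+) t ` {..l}"
        have "s - t > l" if "t \<le> s"
        proof (rule ccontr)
          assume "\<not> s - t > l"
          then have "s \<in> (+) t ` {..l}" using that by (intro image_eqI[of _ _ "s - t"]) auto
          then show False using s by simp
        qed
        then show "(if t \<le> s then (-1) ^ (s + t) * A t * B (s - t) * y ^ s else 0) = 0"
          by (auto simp: B_def binomial_eq_0)
      qed
    qed simp
    also have "\<dots> = (\<Sum>j\<le>l. (-1) ^ j * A t * B j * y ^ (t + j))"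
      by (subst sum.reindex) (auto simp: power_add mult_ac power_mult_distrib[symmetric] intro!: sum.cong)
    also have "\<dots> = (\<Sum>j\<le>l. B j * (- y) ^ j) * (A t * y ^ t)"
      unfolding sum_distrib_right
      by (intro sum.cong refl) (simp add: power_minus[of y] power_add mult_ac)
    also have "(\<Sum>j\<le>l. B j * (- y) ^ j) = (1 - y) ^ l"
      using binomial_ring[of "- y" 1 l] by (simp add: B_def)
    finally show ?thesis .
  qed
  have "(\<Sum>s = 0..l + \<tau> - 1. of_int (alpha_int l \<tau> s) * y ^ s) =
      (\<Sum>s = 0..l + \<tau> - 1. \<Sum>t<\<tau>. (if t \<le> s then (-1) ^ (s + t) * A t * B (s - t) * y ^ s else 0))"
    by (intro sum.cong refl) (auto simp: alpha_int_def A_def B_def sum_distrib_right intro!: sum.cong)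
  also have "\<dots> = (\<Sum>t<\<tau>. \<Sum>s = 0..l + \<tau> - 1. (if t \<le> s then (-1) ^ (s + t) * A t * B (s - t) * y ^ s else 0))"
    by (rule sum.swap)
  also have "\<dots> = (\<Sum>t<\<tau>. (1 - y) ^ l * (A t * y ^ t))"
    by (intro sum.cong refl inner) simp
  finally show ?thesis by (simp add: sum_distrib_left A_def)
qed

lemma power_int_sum:
  fixes x :: "'a::field"
  assumes "x \<noteq> 0"
  shows "x powi (\<Sum>i\<in>A. f i) = (\<Prod>i\<in>A. x powi f i)"
  by (induction A rule: infinite_finite_induct) (auto simp: assms power_int_add)

definition torus :: "('l::field ^ 'n::finite) set" where
  "torus = {c. \<forall>i. c $ i \<noteq> 0}"

lemma
  assumes "finite (UNIV :: 'l::field set)"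
  shows finite_torus: "finite (torus :: ('l ^ 'n::finite) set)"
    and card_torus: "card (torus :: ('l ^ 'n) set) = (CARD('l) - 1) ^ CARD('n)"
proof -
  have bij: "bij_betw vec_lambda ((UNIV :: 'n set) \<rightarrow>\<^sub>E (UNIV - {0 :: 'l})) torus"
    by (intro bij_betwI[where g = vec_nth]) (auto simp: torus_def)
  have "finite ((UNIV :: 'n set) \<rightarrow>\<^sub>E (UNIV - {0 :: 'l}))" using assms by (intro finite_PiE) auto
  then show "finite (torus :: ('l ^ 'n::finite) set)" using bij bij_betw_finite by blast
  have "card (torus :: ('l ^ 'n) set) = card ((UNIV :: 'n set) \<rightarrow>\<^sub>E (UNIV - {0 :: 'l}))"
    using bij_betw_same_card[OF bij] by simp
  also have "\<dots> = (CARD('l) - 1) ^ CARD('n)"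
    using assms by (simp add: card_PiE card_Diff_singleton)
  finally show "card (torus :: ('l ^ 'n) set) = (CARD('l) - 1) ^ CARD('n)" .
qed

section \<open>The Frobenius lift and the trace\<close>

locale frobenius_setting = unramified_padic_field p a v
  for p a :: nat and v :: "'Q::field_char_0 \<Rightarrow> real" +
  fixes \<phi> :: "'Q \<Rightarrow> 'Q" and red :: "'Q \<Rightarrow> 'k::field"
  assumes frob: "frobenius_lift p v \<phi>"
    and red: "reduction_map p v red"
    and card_k: "CARD('k) = p ^ a"
begin

section \<open>Absolute value, divisibility by powers of \<open>p\<close>, and the residue
  field\<close>

abbreviation "Z \<equiv> integer_ring v"

lemma p_gt_1: "p > 1"
  using prime_p prime_gt_1_nat by blast

lemma v_1: "v 1 = 1"
  using v_mult[of 1 1] v_eq_0[of 1] by simp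

lemma v_minus: "v (- x) = v x"
proof -
  have "v (- 1) * v (- 1) = 1" using v_mult[of "- 1" "- 1"] v_1 by simp
  then have "v (- 1) = 1" using v_nonneg[of "- 1"] by (metis abs_of_nonneg abs_mult_self_eq real_sqrt_abs2 real_sqrt_one)
  then show ?thesis using v_mult[of "- 1" x] by simp
qed

lemma v_p_power: "v (of_nat p ^ k) = (1 / real p) ^ k"
  by (induction k) (auto simp: v_1 v_mult v_p)

sublocale Z: subring_set Z
proof -
  have "padic_valued_field p v" by unfold_locales
  note cl = integer_ring_closed[OF this]
  have "- x \<in> Z" if "x \<in> Z" for x using that by (simp add: integer_ring_def v_minus)
  then show "subring_set Z"
    using cl(3)[of _ "- _"] by unfold_locales (auto intro: cl(2,4))
qed

lemma cong_pow_eq: "cong_pow p v m x y \<longleftrightarrow> cong_in Z (of_nat p ^ m) x y"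
  by (simp add: cong_pow_def cong_in_def)

text \<open>Dividing by \<open>of_nat p ^ m\<close> inside the field scales \<open>v\<close> by
  \<open>p ^ m\<close>, and the valuation ring is the unit ball of \<open>v\<close>.\<close>

lemma cong_0_iff: "cong_in Z (of_nat p ^ m) x 0 \<longleftrightarrow> v x \<le> (1 / real p) ^ m"
proof
  assume "cong_in Z (of_nat p ^ m) x 0"
  then show "v x \<le> (1 / real p) ^ m"
    using v_nonneg by (auto simp: cong_in_def v_mult v_p_power integer_ring_def mult_left_le)
next
  assume *: "v x \<le> (1 / real p) ^ m"
  have p0: "(of_nat p :: 'Q) ^ m \<noteq> 0" using p_gt_1 by simp
  have "v x = v (of_nat p ^ m) * v (x / of_nat p ^ m)"
    using p0 by (simp add: v_mult[symmetric])
  then have "(1 / real p) ^ m * v (x / of_nat p ^ m) \<le> (1 / real p) ^ m * 1"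
    using * by (simp add: v_p_power)
  then have "v (x / of_nat p ^ m) \<le> 1"
    using p_gt_1 by (subst (asm) mult_le_cancel_left_pos) auto
  then show "cong_in Z (of_nat p ^ m) x 0"
    using p0 by (auto simp: cong_in_def integer_ring_def intro!: bexI[of _ "x / of_nat p ^ m"])
qed

sublocale red: coeff_hom Z red
  by unfold_locales (use red in \<open>auto simp: reduction_map_def\<close>)

sublocale \<phi>: coeff_hom Z \<phi>
  by unfold_locales (use frob in \<open>auto simp: frobenius_lift_def\<close>)

lemma bij_\<phi>: "bij_betw \<phi> Z Z"
  using frob by (auto simp: frobenius_lift_def)

lemma \<phi>_in: "x \<in> Z \<Longrightarrow> \<phi> x \<in> Z"
  using bij_betw_apply[OF bij_\<phi>] .

lemma red_0_iff: "x \<in> Z \<Longrightarrow> red x = 0 \<longleftrightarrow> cong_in Z (of_nat p) x 0"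
  using red cong_pow_eq[of 1] by (auto simp: reduction_map_def)

lemma red_eq_iff: "x \<in> Z \<Longrightarrow> y \<in> Z \<Longrightarrow> red x = red y \<longleftrightarrow> cong_in Z (of_nat p) x y"
  using red_0_iff[of "x - y"] red.hom_diff[of x y] Z.diff_closed by (auto simp: cong_in_def)

text \<open>Outside the kernel of \<open>red\<close> the absolute value exceeds
  \<open>1 / p\<close>. Since the extension is unramified, non-zero values are integral powers of
  \<open>p\<close>, and none lies strictly between \<open>1 / p\<close> and
  \<open>1\<close>.\<close>

lemma red_nonzero: "x \<in> Z \<Longrightarrow> red x \<noteq> 0 \<Longrightarrow> v x = 1"
proof -
  assume x: "x \<in> Z" and r: "red x \<noteq> 0"
  then have "v x > 1 / real p" using red_0_iff cong_0_iff[of 1 x] by auto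
  moreover have "v x \<le> 1" using x by (simp add: integer_ring_def)
  moreover have "x \<noteq> 0" using r red.hom_0 by auto
  then obtain k where k: "v x = real p powi k" using unramified by blast
  ultimately show ?thesis
  proof -
    assume 1: "v x > 1 / real p" and 2: "v x \<le> 1"
    have "real p powi (-1) < real p powi k" using 1 k by (simp add: power_int_minus divide_simps)
    then have "k \<ge> 0" using p_gt_1 power_int_increasing[of k "-1" "real p"] by force
    moreover have "real p powi k \<le> real p powi 0" using 2 k by simp
    then have "k \<le> 0" using p_gt_1 power_int_strict_increasing[of 0 k "real p"] by force
    ultimately show ?thesis using k by simp
  qed
qed

lemma finite_k: "finite (UNIV :: 'k set)"
  using card_k p_gt_1 by (intro card_ge_0_finite) auto

lemma a_gt_0: "a > 0"
proof (rule ccontr)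
  assume "\<not> a > 0"
  then have "CARD('k) = 1" using card_k by simp
  then obtain z where "(UNIV :: 'k set) = {z}" by (auto simp: card_1_singleton_iff)
  then have "(0 :: 'k) = 1" by (metis UNIV_I singletonD)
  then show False by simp
qed

lemma power_q_cong: "x \<in> Z \<Longrightarrow> cong_in Z (of_nat p) (x ^ (p ^ (a * r))) x"
proof -
  assume x: "x \<in> Z"
  have "red x ^ (p ^ (a * r)) = red x"
  proof (induction r)
    case (Suc r)
    have "red x ^ (p ^ (a * Suc r)) = (red x ^ (p ^ a)) ^ (p ^ (a * r))"
      by (simp add: power_mult[symmetric] power_add)
    also have "red x ^ (p ^ a) = red x"
      using finite_field_power_card[OF finite_k] card_k by metis
    finally show ?case using Suc by simp
  qed simp
  then show ?thesis using x by (subst red_eq_iff[symmetric]) (auto simp: red.hom_power)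
qed

section \<open>Iterates of the Frobenius lift on the coefficient ring\<close>

lemma \<phi>_funpow_cong: "x \<in> Z \<Longrightarrow> cong_in Z (of_nat p) ((\<phi> ^^ i) x) (x ^ (p ^ i))"
proof (induction i)
  case (Suc i)
  have in_Z: "(\<phi> ^^ i) x \<in> Z" using Suc.prems \<phi>_in by (induction i) auto
  then have "cong_in Z (of_nat p) (\<phi> ((\<phi> ^^ i) x)) (((\<phi> ^^ i) x) ^ p)"
    using frob cong_pow_eq[of 1] by (auto simp: frobenius_lift_def)
  moreover have "cong_in Z (of_nat p) (((\<phi> ^^ i) x) ^ p) ((x ^ (p ^ i)) ^ p)"
    using Suc in_Z by (intro Z.cong_power) auto
  ultimately show ?case
    by (auto simp: power_mult[symmetric] mult.commute intro: Z.cong_trans)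
qed simp

text \<open>\<open>\<phi> ^^ a\<close> is the identity modulo every power of \<open>p\<close>, by
  induction on the power. In \<open>x = x ^ (p ^ a) + p * w\<close> the first summand is a
  \<open>p\<close>-th power and gains a factor \<open>p\<close> by
  \<open>cong_power_prime_lift\<close>; the second gains one from the \<open>p\<close> in front. An
  element divisible by all powers of \<open>p\<close> is \<open>0\<close>.\<close>

lemma \<phi>_funpow_a: "x \<in> Z \<Longrightarrow> (\<phi> ^^ a) x = x"
proof -
  interpret s: coeff_hom Z "\<phi> ^^ a"
    using coeff_hom_funpow(1)[OF \<phi>.coeff_hom_axioms] \<phi>_in by blast
  have s_in: "x \<in> Z \<Longrightarrow> (\<phi> ^^ a) x \<in> Z" for x
    using coeff_hom_funpow(2)[OF \<phi>.coeff_hom_axioms] \<phi>_in by blast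
  have D: "x \<in> Z \<Longrightarrow> cong_in Z (of_nat p ^ Suc k) ((\<phi> ^^ a) x) x" for k x
  proof (induction k arbitrary: x)
    case 0
    then show ?case
      using \<phi>_funpow_cong[of x a] power_q_cong[of x 1] by (auto intro: Z.cong_trans)
  next
    case (Suc k)
    obtain w where w: "w \<in> Z" "x = x ^ (p ^ a) + of_nat p * w"
      using Z.cong_sym[OF power_q_cong[OF Suc.prems, of 1]] by (auto simp: cong_in_def algebra_simps)
    define y where "y = x ^ (p ^ (a - 1))"
    have y: "y \<in> Z" "x ^ (p ^ a) = y ^ p"
      using Suc.prems a_gt_0 by (auto simp: y_def power_mult[symmetric] power_Suc2[symmetric] simp del: power_Suc2 power_Suc)
    have "cong_in Z (of_nat p ^ Suc (Suc k)) (((\<phi> ^^ a) y) ^ p) (y ^ p)"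
      using Suc.IH[OF y(1)] s_in y by (intro Z.cong_power_prime_lift) auto
    moreover have "cong_in Z (of_nat p ^ Suc (Suc k)) (of_nat p * (\<phi> ^^ a) w) (of_nat p * w)"
    proof -
      obtain z where "z \<in> Z" "(\<phi> ^^ a) w - w = of_nat p ^ Suc k * z"
        using Suc.IH[OF w(1)] by (auto simp: cong_in_def)
      then show ?thesis
        unfolding cong_in_def by (intro bexI[of _ z]) (simp_all add: mult.assoc flip: right_diff_distrib)
    qed
    ultimately have "cong_in Z (of_nat p ^ Suc (Suc k)) (((\<phi> ^^ a) y) ^ p + of_nat p * (\<phi> ^^ a) w)
        (y ^ p + of_nat p * w)"
      by (rule Z.cong_add)
    moreover have "(\<phi> ^^ a) (y ^ p + of_nat p * w) = ((\<phi> ^^ a) y) ^ p + of_nat p * (\<phi> ^^ a) w"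
      using y w by (simp add: s.hom_add s.hom_mult s.hom_power s.hom_of_nat Z.power_closed Z.mult_closed)
    moreover have "x = y ^ p + of_nat p * w" using w y by simp
    ultimately show ?case by simp
  qed
  assume x: "x \<in> Z"
  define d where "d = (\<phi> ^^ a) x - x"
  have "v d \<le> (1 / real p) ^ Suc k" for k
    using D[OF x, of k] cong_0_iff[of "Suc k" d] by (simp add: cong_in_def d_def)
  moreover have "(\<lambda>k. (1 / real p) ^ Suc k) \<longlonglongrightarrow> 0"
    using p_gt_1 by (intro LIMSEQ_Suc LIMSEQ_realpow_zero) auto
  ultimately have "v d \<le> 0" by (intro LIMSEQ_le_const) auto
  then have "d = 0" using v_nonneg[of d] v_eq_0[of d] by simp
  then show ?thesis by (simp add: d_def)
qed

lemma \<phi>_funpow_mult: "x \<in> Z \<Longrightarrow> (\<phi> ^^ (a * r)) x = x"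
  by (induction r) (auto simp: funpow_add \<phi>_funpow_a)

abbreviation "\<phi>i \<equiv> inv_into Z \<phi>"

lemma \<phi>i_in: "x \<in> Z \<Longrightarrow> \<phi>i x \<in> Z"
  and \<phi>_\<phi>i: "x \<in> Z \<Longrightarrow> \<phi> (\<phi>i x) = x"
  and \<phi>i_\<phi>: "x \<in> Z \<Longrightarrow> \<phi>i (\<phi> x) = x"
  using bij_\<phi> by (auto simp: bij_betw_def inv_into_into f_inv_into_f)

sublocale \<phi>i: coeff_hom Z \<phi>i
proof (unfold_locales, unfold ring_hom_on_def, intro conjI ballI)
  show "\<phi>i 1 = 1" using \<phi>i_\<phi>[of 1] \<phi>.hom_1 by simp
  fix x y assume xy: "x \<in> Z" "y \<in> Z"
  show "\<phi>i (x + y) = \<phi>i x + \<phi>i y"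
    using \<phi>i_\<phi>[of "\<phi>i x + \<phi>i y"] xy by (simp add: \<phi>.hom_add \<phi>i_in \<phi>_\<phi>i Z.add_closed)
  show "\<phi>i (x * y) = \<phi>i x * \<phi>i y"
    using \<phi>i_\<phi>[of "\<phi>i x * \<phi>i y"] xy by (simp add: \<phi>.hom_mult \<phi>i_in \<phi>_\<phi>i Z.mult_closed)
qed

lemma \<phi>i_funpow_mult: "x \<in> Z \<Longrightarrow> (\<phi>i ^^ (a * r)) x = x"
proof -
  have "x \<in> Z \<Longrightarrow> (\<phi>i ^^ n) ((\<phi> ^^ n) x) = x" for n
  proof (induction n arbitrary: x)
    case (Suc n)
    have "(\<phi> ^^ n) x \<in> Z" using Suc.prems \<phi>_in by (induction n) auto
    then have "\<phi>i (\<phi> ((\<phi> ^^ n) x)) = (\<phi> ^^ n) x" by (rule \<phi>i_\<phi>)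
    moreover have "(\<phi>i ^^ Suc n) ((\<phi> ^^ Suc n) x) = (\<phi>i ^^ n) (\<phi>i (\<phi> ((\<phi> ^^ n) x)))"
      by (metis comp_apply funpow.simps(2) funpow_Suc_right)
    ultimately show ?case using Suc by simp
  qed simp
  then show "x \<in> Z \<Longrightarrow> (\<phi>i ^^ (a * r)) x = x" using \<phi>_funpow_mult by metis
qed

section \<open>The Frobenius lift on Laurent polynomials and the iterates of
  \<open>A_op\<close>\<close>

lemma padic_valued: "padic_valued_field p v"
  by unfold_locales

lemma unramified_padic: "unramified_padic_field p a v"
  by unfold_locales

lemma integral_laurent_eq: "integral_laurent v = coeffs_in Z"
  by (simp add: integral_laurent_def coeffs_in_def)

lemma coeffs_subring: "subring_set (coeffs_in Z :: ('b::ab_group_add \<Rightarrow>\<^sub>0 'Q) set)"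
  by (intro subring_set_coeffs_in Z.subring_set_axioms)

text \<open>The extension of \<open>\<phi>\<close> to Laurent polynomials. Written through
  \<open>pm_eval\<close>, it is a ring homomorphism on integral polynomials by
  \<open>pm_eval_ring_hom\<close>.\<close>

definition Frob :: "('n::finite, 'Q) laurent \<Rightarrow> ('n, 'Q) laurent" where
  "Frob = pm_eval (\<lambda>c. Poly_Mapping.single 0 (\<phi> c)) (\<lambda>u. Poly_Mapping.single (int p *s u) 1)"

lemma Frob_eq:
  "Frob G = (\<Sum>u\<in>Poly_Mapping.keys G. Poly_Mapping.single (int p *s u) (\<phi> (Poly_Mapping.lookup G u)))"
  by (simp add: Frob_def pm_eval_def mult_single)

lemma coeff_hom_Frob: "coeff_hom (coeffs_in Z) (Frob :: ('n::finite, 'Q) laurent \<Rightarrow> _)"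
proof -
  interpret h: coeff_hom Z "\<lambda>c. Poly_Mapping.single (0 :: int ^ 'n) (\<phi> c)"
    by unfold_locales
      (auto simp: ring_hom_on_def \<phi>.hom_1 \<phi>.hom_add \<phi>.hom_mult single_add mult_single)
  show ?thesis unfolding Frob_def
    by (rule h.pm_eval_ring_hom) (auto simp: mult_single vector_add_ldistrib)
qed

lemma Frob_in: "G \<in> coeffs_in Z \<Longrightarrow> Frob G \<in> coeffs_in Z"
  unfolding Frob_eq
  by (intro subring_set.sum_closed[OF coeffs_subring] single_in_coeffs_in)
    (auto simp: coeffs_in_def \<phi>_in)

lemma Frob_P_module:
  assumes "G \<in> P_module v (dilate s K)"
  shows "Frob G \<in> P_module v (dilate (p * s) K)"
proof -
  have G: "G \<in> coeffs_in Z" "\<And>u. u \<in> Poly_Mapping.keys G \<Longrightarrow> real_point u \<in> dilate s K"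
    using assms by (auto simp: P_module_def integral_laurent_eq lattice_points_def)
  have "real_point w \<in> dilate (p * s) K" if "w \<in> Poly_Mapping.keys (Frob G)" for w
  proof -
    have "Poly_Mapping.lookup (Frob G) w \<noteq> 0" using that by (simp add: in_keys_iff)
    then obtain u where u: "u \<in> Poly_Mapping.keys G" "w = int p *s u"
      unfolding Frob_eq lookup_sum
      by (metis (no_types, lifting) lookup_single_not_eq sum.not_neutral_contains_not_neutral)
    then obtain x where x: "x \<in> K" "real_point u = real s *\<^sub>R x"
      using G(2)[of u] by (auto simp: dilate_def)
    have "real_point w = real p *\<^sub>R real_point u"
      by (simp add: u real_point_def vec_eq_iff)
    then have "real_point w = real (p * s) *\<^sub>R x" by (simp add: x)
    then show ?thesis using x by (auto simp: dilate_def)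
  qed
  then show ?thesis
    using Frob_in[OF G(1)] by (auto simp: P_module_def integral_laurent_eq lattice_points_def)
qed

text \<open>Modulo \<open>p\<close> a \<open>p\<close>-th power can be taken term by term, and on
  coefficients \<open>\<phi>\<close> is the \<open>p\<close>-th power.\<close>

lemma Frob_cong:
  assumes "G \<in> coeffs_in Z"
  shows "cong_in (coeffs_in Z) (of_nat p) (Frob G) (G ^ p)"
proof -
  interpret L: subring_set "coeffs_in Z :: ('n::finite, 'Q) laurent set" by (rule coeffs_subring)
  have in_Z: "Poly_Mapping.lookup G u \<in> Z" for u using assms by (auto simp: coeffs_in_def)
  have "cong_in (coeffs_in Z) (of_nat p)
      ((\<Sum>u\<in>Poly_Mapping.keys G. Poly_Mapping.single u (Poly_Mapping.lookup G u)) ^ p)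
      (\<Sum>u\<in>Poly_Mapping.keys G. Poly_Mapping.single u (Poly_Mapping.lookup G u) ^ p)"
    by (intro L.freshman_dream_sum prime_p single_in_coeffs_in in_Z) auto
  moreover have "cong_in (coeffs_in Z) (of_nat p)
      (\<Sum>u\<in>Poly_Mapping.keys G. Poly_Mapping.single u (Poly_Mapping.lookup G u) ^ p) (Frob G)"
    unfolding Frob_eq
  proof (rule L.cong_sum)
    fix u
    have "cong_in Z (of_nat p) (Poly_Mapping.lookup G u ^ p) (\<phi> (Poly_Mapping.lookup G u))"
      using Z.cong_sym[OF \<phi>_funpow_cong[OF in_Z, of 1]] by simp
    then obtain z where z: "z \<in> Z" "Poly_Mapping.lookup G u ^ p - \<phi> (Poly_Mapping.lookup G u) = of_nat p * z"
      by (auto simp: cong_in_def)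
    have s: "(\<Sum>i<n. u) = int n *s u" for n
      by (induction n) (simp_all add: vec_eq_iff algebra_simps del: sum_constant)
    have "Poly_Mapping.single u (Poly_Mapping.lookup G u) ^ p -
        Poly_Mapping.single (int p *s u) (\<phi> (Poly_Mapping.lookup G u)) =
        of_nat p * Poly_Mapping.single (int p *s u) z"
      unfolding single_power s single_diff[symmetric] z(2)
      by (simp add: mult_single flip: single_of_nat)
    then show "cong_in (coeffs_in Z) (of_nat p) (Poly_Mapping.single u (Poly_Mapping.lookup G u) ^ p)
        (Poly_Mapping.single (int p *s u) (\<phi> (Poly_Mapping.lookup G u)))"
      unfolding cong_in_def using z by (intro bexI) (auto intro: single_in_coeffs_in)
  qed
  ultimately show ?thesis
    unfolding poly_mapping_sum_single[of _ G, OF finite_keys subset_refl, symmetric]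
    by (auto intro: L.cong_sym L.cong_trans)
qed

text \<open>The projection formula \<open>g * psi(X) = psi(Frob(g) * X)\<close>, coefficient by
  coefficient: \<open>p * w - p * u = p * (w - u)\<close>, and \<open>\<phi>i\<close> undoes
  \<open>\<phi>\<close>.\<close>

lemma lookup_mult_psi:
  fixes g X :: "('n::finite, 'Q) laurent"
  assumes "g \<in> coeffs_in Z" "X \<in> coeffs_in Z"
  shows "Poly_Mapping.lookup (g * psi p v \<phi> X) w = \<phi>i (Poly_Mapping.lookup (Frob g * X) (int p *s w))"
proof -
  have in_Z: "Poly_Mapping.lookup g u \<in> Z" "Poly_Mapping.lookup X u \<in> Z" for u
    using assms by (auto simp: coeffs_in_def)
  have "Poly_Mapping.lookup (Frob g * X) (int p *s w) =
      (\<Sum>u\<in>Poly_Mapping.keys g. \<phi> (Poly_Mapping.lookup g u) * Poly_Mapping.lookup X (int p *s (w - u)))"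
    unfolding Frob_eq
    by (simp add: sum_distrib_right lookup_sum lookup_single_mult vector_ssub_ldistrib)
  then have "\<phi>i (Poly_Mapping.lookup (Frob g * X) (int p *s w)) =
      (\<Sum>u\<in>Poly_Mapping.keys g. Poly_Mapping.lookup g u * \<phi>i (Poly_Mapping.lookup X (int p *s (w - u))))"
    by (simp add: \<phi>i.hom_sum \<phi>i.hom_mult in_Z \<phi>_in \<phi>i_\<phi> Z.mult_closed)
  then show ?thesis
    by (simp add: lookup_mult_eq_sum[OF finite_keys subset_refl, of g] lookup_psi[OF unramified_padic frob])
qed

text \<open>The multiplier collected when all the \<open>psi\<close> in \<open>m\<close> iterates of
  \<open>A_op\<close> are moved to the left; see \<open>lookup_A_op_funpow\<close>.\<close>

definition frob_prod :: "('n::finite, 'Q) laurent \<Rightarrow> nat \<Rightarrow> ('n, 'Q) laurent" where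
  "frob_prod H m = (\<Prod>i<m. (Frob ^^ i) H ^ (p - 1))"

lemma Frob_funpow_in: "H \<in> coeffs_in Z \<Longrightarrow> (Frob ^^ i) H \<in> coeffs_in Z"
  by (induction i) (auto intro: Frob_in)

lemma frob_prod_in: "H \<in> coeffs_in Z \<Longrightarrow> frob_prod H m \<in> coeffs_in Z"
  unfolding frob_prod_def
  by (intro subring_set.prod_closed[OF coeffs_subring] subring_set.power_closed[OF coeffs_subring]
      Frob_funpow_in)

lemma frob_prod_Suc:
  assumes "H \<in> coeffs_in Z"
  shows "frob_prod H (Suc m) = Frob (frob_prod H m) * H ^ (p - 1)"
proof -
  interpret F: coeff_hom "coeffs_in Z" "Frob :: ('n::finite, 'Q) laurent \<Rightarrow> _" by (rule coeff_hom_Frob)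
  have "Frob (frob_prod H m) = (\<Prod>i<m. (Frob ^^ Suc i) H ^ (p - 1))"
    unfolding frob_prod_def using assms
    by (simp add: F.hom_prod F.hom_power Frob_funpow_in F.power_closed)
  then show ?thesis
    unfolding frob_prod_def prod.lessThan_Suc_shift by (simp add: mult.commute)
qed

lemma frob_prod_power:
  assumes "H \<in> coeffs_in Z"
  shows "frob_prod (H ^ s) m = frob_prod H m ^ s"
proof (induction m)
  case (Suc m)
  interpret F: coeff_hom "coeffs_in Z" "Frob :: ('n::finite, 'Q) laurent \<Rightarrow> _" by (rule coeff_hom_Frob)
  show ?case using assms Suc
    by (simp add: frob_prod_Suc F.power_closed F.hom_power frob_prod_in power_mult_distrib
        power_mult[symmetric] mult.commute)
qed (simp add: frob_prod_def)

text \<open>Each \<open>Frob\<close> stretches exponents by \<open>p\<close>, so the dilation factor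
  is \<open>(p - 1) * (1 + p + ... + p ^ (m - 1)) = p ^ m - 1\<close>.\<close>

lemma frob_prod_P_module:
  assumes K: "convex K" "K \<noteq> {}" and H: "H \<in> P_module v K"
  shows "frob_prod H m \<in> P_module v (dilate (p ^ m - 1) K)"
proof (induction m)
  case 0
  show ?case
    using P_module_power[OF padic_valued K, of H 1 0] H by (simp add: frob_prod_def dilate_def)
next
  case (Suc m)
  have "H ^ (p - 1) \<in> P_module v (dilate (p - 1) K)"
    using P_module_power[OF padic_valued K, of H 1 "p - 1"] H by (simp add: dilate_def)
  then have "Frob (frob_prod H m) * H ^ (p - 1) \<in> P_module v (dilate (p * (p ^ m - 1) + (p - 1)) K)"
    using Suc by (intro P_module_mult[OF padic_valued K(1)] Frob_P_module)
  moreover have "p * (p ^ m - 1) + (p - 1) = p ^ Suc m - 1"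
    using p_gt_1 by (simp add: diff_mult_distrib2)
  ultimately show ?case
    using H by (simp add: frob_prod_Suc P_module_def integral_laurent_eq)
qed

text \<open>Modulo \<open>p\<close> each \<open>Frob\<close> is a \<open>p\<close>-th power, and the
  exponents form the same geometric sum. For \<open>m = a * r\<close> the result is the order of the
  multiplicative group of the field with \<open>q ^ r\<close> elements.\<close>

lemma frob_prod_cong:
  assumes "H \<in> coeffs_in Z"
  shows "cong_in (coeffs_in Z) (of_nat p) (frob_prod H m) (H ^ (p ^ m - 1))"
proof (induction m)
  case (Suc m)
  interpret L: subring_set "coeffs_in Z :: ('n::finite, 'Q) laurent set" by (rule coeffs_subring)
  have "cong_in (coeffs_in Z) (of_nat p) (Frob (frob_prod H m)) ((H ^ (p ^ m - 1)) ^ p)"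
    using Frob_cong[OF frob_prod_in[OF assms], of m] L.cong_power[OF Suc, of p] assms
    by (auto intro: L.cong_trans frob_prod_in)
  then have "cong_in (coeffs_in Z) (of_nat p) (Frob (frob_prod H m) * H ^ (p - 1))
      ((H ^ (p ^ m - 1)) ^ p * H ^ (p - 1))"
    using assms by (intro L.cong_mult) auto
  also have "(H ^ (p ^ m - 1)) ^ p * H ^ (p - 1) = H ^ ((p ^ m - 1) * p + (p - 1))"
    by (simp add: power_add power_mult)
  also have "(p ^ m - 1) * p + (p - 1) = p ^ Suc m - 1"
    using p_gt_1 by (subst mult.commute) (simp add: diff_mult_distrib2)
  finally show ?case using assms by (simp add: frob_prod_Suc)
qed (simp add: frob_prod_def subring_set.cong_refl[OF coeffs_subring])

lemma Frob_funpow_cong: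
  assumes "H \<in> coeffs_in Z"
  shows "cong_in (coeffs_in Z) (of_nat p) ((Frob ^^ i) H) (H ^ (p ^ i))"
proof (induction i)
  case (Suc i)
  interpret L: subring_set "coeffs_in Z :: ('n::finite, 'Q) laurent set" by (rule coeffs_subring)
  have "cong_in (coeffs_in Z) (of_nat p) (Frob ((Frob ^^ i) H)) ((H ^ (p ^ i)) ^ p)"
    using Frob_cong[OF Frob_funpow_in[OF assms], of i] L.cong_power[OF Suc, of p] assms
    by (auto intro: L.cong_trans Frob_funpow_in)
  then show ?case by (simp add: power_mult[symmetric] mult.commute)
qed (simp add: subring_set.cong_refl[OF coeffs_subring])

text \<open>In coefficients: \<open>m\<close> iterates of \<open>A_op\<close> are multiplication by
  \<open>frob_prod H m\<close> followed by \<open>m\<close> iterates of \<open>psi\<close>. The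
  innermost application is split off, so the induction needs arbitrary \<open>X\<close>; each step
  uses \<open>lookup_mult_psi\<close>.\<close>

lemma lookup_A_op_funpow:
  fixes H X :: "('n::finite, 'Q) laurent"
  assumes H: "H \<in> coeffs_in Z" and "X \<in> coeffs_in Z"
  shows "Poly_Mapping.lookup ((A_op p v \<phi> H ^^ m) X) u =
    (\<phi>i ^^ m) (Poly_Mapping.lookup (frob_prod H m * X) (int (p ^ m) *s u))"
  using assms(2)
proof (induction m arbitrary: X)
  case 0
  then show ?case by (simp add: frob_prod_def)
next
  case (Suc m)
  interpret L: subring_set "coeffs_in Z :: ('n, 'Q) laurent set" by (rule coeffs_subring)
  have HX: "H ^ (p - 1) * X \<in> coeffs_in Z" using H Suc.prems by auto
  have A: "A_op p v \<phi> H X \<in> coeffs_in Z"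
    using HX by (auto simp: A_op_def coeffs_in_def lookup_psi[OF unramified_padic frob] \<phi>i_in)
  have "Poly_Mapping.lookup ((A_op p v \<phi> H ^^ Suc m) X) u =
      Poly_Mapping.lookup ((A_op p v \<phi> H ^^ m) (A_op p v \<phi> H X)) u"
    by (simp only: funpow_Suc_right o_apply)
  also have "\<dots> = (\<phi>i ^^ m) (Poly_Mapping.lookup (frob_prod H m * psi p v \<phi> (H ^ (p - 1) * X)) (int (p ^ m) *s u))"
    unfolding Suc.IH[OF A] by (simp add: A_op_def)
  also have "\<dots> = (\<phi>i ^^ m) (\<phi>i (Poly_Mapping.lookup (Frob (frob_prod H m) * (H ^ (p - 1) * X))
      (int p *s (int (p ^ m) *s u))))"
    by (subst lookup_mult_psi[OF frob_prod_in[OF H] HX]) simp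
  also have "\<dots> = (\<phi>i ^^ Suc m) (Poly_Mapping.lookup (frob_prod H (Suc m) * X) (int (p ^ Suc m) *s u))"
    by (simp add: frob_prod_Suc[OF H] funpow_swap1 mult.assoc vector_smult_assoc)
  finally show ?case .
qed

section \<open>The trace as a sum of coefficients\<close>

definition divisible_sum :: "nat \<Rightarrow> ('n::finite, 'Q) laurent \<Rightarrow> 'Q" where
  "divisible_sum N G = (\<Sum>w | w \<in> Poly_Mapping.keys G \<and> (\<forall>i. int N dvd w $ i). Poly_Mapping.lookup G w)"

text \<open>With \<open>m = a * r\<close>, the diagonal entry at \<open>u\<close> is the coefficient
  at \<open>p ^ m * u - u\<close>, that is at \<open>N * u\<close>; it is not twisted because
  \<open>\<phi>i ^^ m\<close> is the identity on \<open>Z\<close>.\<close>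

lemma P_trace_A_op:
  fixes H :: "('n::finite, 'Q) laurent"
  assumes K: "convex K" "K \<noteq> {}" "bounded K" and H: "H \<in> P_module v K" and r: "r > 0"
  shows "P_trace K (A_op p v \<phi> H ^^ (a * r)) =
    divisible_sum (p ^ (a * r) - 1) (frob_prod H (a * r))"
proof -
  define m where "m = a * r"
  define N where "N = p ^ m - 1"
  define g where "g = frob_prod H m"
  have Hc: "H \<in> coeffs_in Z" using H by (simp add: P_module_def integral_laurent_eq)
  have g: "g \<in> coeffs_in Z" "g \<in> P_module v (dilate N K)"
    using frob_prod_in[OF Hc] frob_prod_P_module[OF K(1,2) H] by (auto simp: g_def N_def)
  have "m > 0" using a_gt_0 r by (simp add: m_def)
  then have N: "N > 0" using p_gt_1 one_less_power[of p m] by (simp add: N_def)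
  have pN: "int (p ^ m) = int N + 1" using p_gt_1 by (simp add: N_def of_nat_diff)
  have "P_trace K (A_op p v \<phi> H ^^ m) = (\<Sum>u\<in>lattice_points K. Poly_Mapping.lookup g (int N *s u))"
    unfolding P_trace_def
  proof (rule sum.cong[OF refl])
    fix u :: "int ^ 'n"
    have "Poly_Mapping.lookup ((A_op p v \<phi> H ^^ m) (Poly_Mapping.single u 1)) u =
        (\<phi>i ^^ m) (Poly_Mapping.lookup (Poly_Mapping.single u 1 * g) (int (p ^ m) *s u))"
      by (subst lookup_A_op_funpow[OF Hc]) (auto intro!: single_in_coeffs_in simp: g_def mult.commute)
    also have "\<dots> = (\<phi>i ^^ m) (Poly_Mapping.lookup g (int N *s u))"
      by (simp only: lookup_single_mult pN) (simp add: vector_sadd_rdistrib)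
    also have "\<dots> = Poly_Mapping.lookup g (int N *s u)"
      unfolding m_def using g by (intro \<phi>i_funpow_mult) (auto simp: coeffs_in_def)
    finally show "Poly_Mapping.lookup ((A_op p v \<phi> H ^^ m) (Poly_Mapping.single u 1)) u =
        Poly_Mapping.lookup g (int N *s u)" .
  qed
  also have "\<dots> = (\<Sum>w\<in>(\<lambda>u. int N *s u) ` lattice_points K. Poly_Mapping.lookup g w)"
    using inj_scale[OF N] by (subst sum.reindex) (auto intro: inj_on_subset)
  also have "\<dots> = divisible_sum N g"
    unfolding divisible_sum_def
  proof (rule sum.mono_neutral_right)
    show "finite ((\<lambda>u. int N *s u) ` lattice_points K)"
      using finite_lattice_points[OF K(3)] by simp
    \<comment> \<open>The support of \<open>g\<close> lies in the dilate of \<open>K\<close> by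
      \<open>N\<close>, so every exponent divisible by \<open>N\<close> comes from a lattice point
      of \<open>K\<close>.\<close>
    show "{w \<in> Poly_Mapping.keys g. \<forall>i. int N dvd w $ i} \<subseteq> (\<lambda>u. int N *s u) ` lattice_points K"
    proof
      fix w assume w: "w \<in> {w \<in> Poly_Mapping.keys g. \<forall>i. int N dvd w $ i}"
      define u where "u = (\<chi> i. w $ i div int N)"
      have wu: "w = int N *s u" using w by (simp add: u_def vec_eq_iff)
      obtain x where x: "x \<in> K" "real_point w = real N *\<^sub>R x"
        using g(2) w by (auto simp: P_module_def lattice_points_def dilate_def)
      then have "real_point u = x"
        using N by (simp add: wu real_point_def vec_eq_iff)
      then show "w \<in> (\<lambda>u. int N *s u) ` lattice_points K"
        using x wu by (auto simp: lattice_points_def)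
    qed
    show "\<forall>w\<in>(\<lambda>u. int N *s u) ` lattice_points K - {w \<in> Poly_Mapping.keys g. \<forall>i. int N dvd w $ i}.
        Poly_Mapping.lookup g w = 0"
      by (auto simp: in_keys_iff)
  qed
  finally show ?thesis by (simp add: m_def N_def g_def)
qed

end

section \<open>Roots of unity without the extension field\<close>

locale test_ring = frobenius_setting p a v \<phi> red
  for p a :: nat and v :: "'Q::field_char_0 \<Rightarrow> real" and \<phi> :: "'Q \<Rightarrow> 'Q" and red :: "'Q \<Rightarrow> 'k::field" +
  fixes \<iota> :: "'k \<Rightarrow> 'l::field" and r :: nat and \<gamma> :: 'l
  assumes hom_\<iota>: "ring_hom_on UNIV \<iota>"
    and card_l: "CARD('l) = p ^ (a * r)"
    and r_gt_0: "r > 0"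
    and \<gamma>_nonzero: "\<gamma> \<noteq> 0"
    and \<gamma>_generates: "y \<noteq> 0 \<Longrightarrow> \<exists>i::nat. y = \<gamma> ^ i"
begin

definition N :: nat where "N = p ^ (a * r) - 1"

lemma N_gt_0: "N > 0"
  using one_less_power[of p "a * r"] p_gt_1 a_gt_0 r_gt_0 by (simp add: N_def)

lemma Suc_N: "p ^ (a * r) = Suc N"
  using p_gt_1 by (simp add: N_def)

lemma finite_l: "finite (UNIV :: 'l set)"
  using card_l p_gt_1 by (intro card_ge_0_finite) auto

lemma \<gamma>_powi_N_mult: "\<gamma> powi (int N * k) = 1"
proof -
  have "\<gamma> ^ N = 1"
    using finite_field_power_card_minus_1[OF finite_l \<gamma>_nonzero] card_l by (simp add: N_def)
  then show ?thesis by (simp add: power_int_mult)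
qed

lemma \<gamma>_powi_mod: "\<gamma> powi k = \<gamma> powi (k mod int N)"
proof -
  have "\<gamma> powi k = \<gamma> powi (int N * (k div int N) + k mod int N)" by simp
  also have "\<dots> = \<gamma> powi (k mod int N)"
    using \<gamma>_nonzero \<gamma>_powi_N_mult by (subst power_int_add) auto
  finally show ?thesis .
qed

text \<open>If \<open>\<gamma> ^ d = 1\<close> with \<open>0 < d < N\<close>, the powers of
  \<open>\<gamma>\<close> take at most \<open>d\<close> values and cannot exhaust the
  \<open>N\<close> non-zero elements.\<close>

lemma \<gamma>_powi_eq_1: "\<gamma> powi k = 1 \<Longrightarrow> int N dvd k"
proof (rule ccontr)
  assume k: "\<gamma> powi k = 1" and ndvd: "\<not> int N dvd k"
  define d where "d = nat (k mod int N)"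
  have d: "0 < d" "d < N" "int d = k mod int N"
  proof -
    have "0 \<le> k mod int N" "k mod int N < int N" using N_gt_0 by auto
    moreover have "k mod int N \<noteq> 0" using ndvd by (simp add: dvd_eq_mod_eq_0)
    ultimately show "0 < d" "d < N" "int d = k mod int N" by (auto simp: d_def)
  qed
  have "\<gamma> ^ d = 1" using k \<gamma>_powi_mod[of k] d(3) by (metis power_int_of_nat)
  have "UNIV - {0} \<subseteq> (\<lambda>i. \<gamma> ^ i) ` {..<d}"
  proof
    fix y :: 'l assume "y \<in> UNIV - {0}"
    then obtain i where "y = \<gamma> ^ i" using \<gamma>_generates by auto
    also have "\<gamma> ^ i = \<gamma> ^ (d * (i div d) + i mod d)" by simp
    also have "\<dots> = \<gamma> ^ (i mod d)" using \<open>\<gamma> ^ d = 1\<close> by (simp only: power_add power_mult) simp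
    finally show "y \<in> (\<lambda>i. \<gamma> ^ i) ` {..<d}" using d by auto
  qed
  then have "card (UNIV - {0 :: 'l}) \<le> card ((\<lambda>i. \<gamma> ^ i) ` {..<d})"
    by (intro card_mono) auto
  also have "\<dots> \<le> d" using card_image_le[of "{..<d}" "\<lambda>i. \<gamma> ^ i"] by simp
  finally show False using d card_l finite_l by (simp add: card_Diff_singleton N_def)
qed

abbreviation S :: "(int \<Rightarrow>\<^sub>0 'Q) set" where "S \<equiv> coeffs_in Z"

sublocale S: subring_set S
  by (rule coeffs_subring)

definition e :: "(int \<Rightarrow>\<^sub>0 'Q) \<Rightarrow> 'l" where
  "e = pm_eval (\<lambda>c. \<iota> (red c)) (\<lambda>k. \<gamma> powi k)"

sublocale \<iota>: coeff_hom UNIV \<iota>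
  by unfold_locales (auto simp: hom_\<iota>)

sublocale \<iota>red: coeff_hom Z "\<lambda>c. \<iota> (red c)"
  by unfold_locales
    (auto simp: ring_hom_on_def red.hom_1 red.hom_add red.hom_mult \<iota>.hom_1 \<iota>.hom_add \<iota>.hom_mult)

sublocale e: coeff_hom S e
  unfolding e_def using \<gamma>_nonzero by (intro \<iota>red.pm_eval_ring_hom) (auto simp: power_int_add)

lemma e_single: "e (Poly_Mapping.single k c) = \<iota> (red c) * \<gamma> powi k"
  by (simp add: e_def \<iota>red.pm_eval_single)

lemma single_in_S: "c \<in> Z \<Longrightarrow> Poly_Mapping.single k c \<in> S"
  by (simp add: single_in_coeffs_in)

section \<open>Congruences modulo powers of \<open>p\<close> and \<open>T\<close>, localised at the
  kernel of \<open>e\<close>\<close>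

definition T :: "int \<Rightarrow>\<^sub>0 'Q" where "T = Poly_Mapping.single (int N) 1 - 1"

lemma T_in: "T \<in> S"
  by (auto simp: T_def intro: single_in_S)

text \<open>By the geometric sum \<open>T\<close> divides \<open>t ^ (N * n) - 1\<close>; a negative
  difference is handled by exchanging \<open>i\<close> and \<open>j\<close>.\<close>

lemma single_cong_T:
  assumes c: "c \<in> Z" and "int N dvd i - j"
  shows "cong_in S T (Poly_Mapping.single i c) (Poly_Mapping.single j c)"
proof -
  have nonneg: "cong_in S T (Poly_Mapping.single (j + int N * int n) c) (Poly_Mapping.single j c)" for j n
  proof -
    have "Poly_Mapping.single (j + int N * int n) c =
        Poly_Mapping.single j c * Poly_Mapping.single (int N) 1 ^ n"
      by (simp add: single_power mult_single mult.commute)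
    then have "Poly_Mapping.single (j + int N * int n) c - Poly_Mapping.single j c =
        Poly_Mapping.single j c * (Poly_Mapping.single (int N) 1 ^ n - 1)"
      by (simp add: right_diff_distrib)
    also have "\<dots> = T * (Poly_Mapping.single j c * (\<Sum>i<n. Poly_Mapping.single (int N) 1 ^ i))"
      by (simp add: power_diff_1_eq T_def mult_ac)
    finally show ?thesis
      unfolding cong_in_def
      by (rule bexI) (intro S.mult_closed S.sum_closed S.power_closed single_in_S c Z.one_closed)
  qed
  obtain k where k: "i = j + int N * k" using assms(2) by (metis add_diff_cancel_left' diff_add_cancel dvdE add.commute)
  show ?thesis
  proof (cases "k \<ge> 0")
    case True
    then show ?thesis using nonneg[of j "nat k"] k by simp
  next
    case False
    then show ?thesis using nonneg[of i "nat (- k)"] k by (auto intro: S.cong_sym)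
  qed
qed

text \<open>With \<open>\<pp>\<close> the kernel of \<open>e\<close>, this is the kernel of the map from \<open>\<int>\<^sub>q[t\<^sup>\<plusminus>]\<close> to the localisation of
  \<open>\<int>\<^sub>q[t\<^sup>\<plusminus>]/(p^k, T)\<close> at \<open>\<pp>\<close>; that localisation is the ring of integers of \<open>\<rat>\<^bsub>q^r\<^esub>\<close> modulo \<open>p^k\<close>.\<close>

definition I :: "nat \<Rightarrow> (int \<Rightarrow>\<^sub>0 'Q) set" where
  "I k = {x. \<exists>w\<in>S. \<exists>y\<in>S. \<exists>z\<in>S. e w \<noteq> 0 \<and> w * x = of_nat p ^ k * y + T * z}"

lemma I_I: "w \<in> S \<Longrightarrow> y \<in> S \<Longrightarrow> z \<in> S \<Longrightarrow> e w \<noteq> 0 \<Longrightarrow> w * x = of_nat p ^ k * y + T * z \<Longrightarrow> x \<in> I k"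
  unfolding I_def by blast

lemma I_E:
  assumes "x \<in> I k"
  obtains w y z where "w \<in> S" "y \<in> S" "z \<in> S" "e w \<noteq> 0" "w * x = of_nat p ^ k * y + T * z"
  using assms unfolding I_def by blast

lemma I_p_power_mult: "y \<in> S \<Longrightarrow> of_nat p ^ k * y \<in> I k"
  by (rule I_I[of 1 y 0]) (auto simp: e.hom_1)

lemma I_T_mult: "z \<in> S \<Longrightarrow> T * z \<in> I k"
  by (rule I_I[of 1 0 z]) (auto simp: e.hom_1)

lemma I_0: "0 \<in> I k"
  using I_T_mult[of 0] by simp

lemma I_add:
  assumes "x \<in> I k" "x' \<in> I k"
  shows "x + x' \<in> I k"
proof -
  obtain w y z where x: "w \<in> S" "y \<in> S" "z \<in> S" "e w \<noteq> 0" "w * x = of_nat p ^ k * y + T * z"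
    using assms(1) by (rule I_E)
  obtain w' y' z' where x': "w' \<in> S" "y' \<in> S" "z' \<in> S" "e w' \<noteq> 0" "w' * x' = of_nat p ^ k * y' + T * z'"
    using assms(2) by (rule I_E)
  have "w * w' * (x + x') = w' * (w * x) + w * (w' * x')" by (simp add: algebra_simps)
  also have "\<dots> = of_nat p ^ k * (w' * y + w * y') + T * (w' * z + w * z')"
    unfolding x(5) x'(5) by (simp add: algebra_simps)
  finally show ?thesis
    using x x' by (intro I_I[of "w * w'"]) (auto simp: e.hom_mult)
qed

text \<open>When the two representations are multiplied, every term except the one with
  \<open>p ^ (j + k)\<close> contains \<open>T\<close>.\<close>

lemma I_mult:
  assumes "x \<in> I j" "x' \<in> I k"
  shows "x * x' \<in> I (j + k)"
proof -
  obtain w y z where x: "w \<in> S" "y \<in> S" "z \<in> S" "e w \<noteq> 0" "w * x = of_nat p ^ j * y + T * z"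
    using assms(1) by (rule I_E)
  obtain w' y' z' where x': "w' \<in> S" "y' \<in> S" "z' \<in> S" "e w' \<noteq> 0" "w' * x' = of_nat p ^ k * y' + T * z'"
    using assms(2) by (rule I_E)
  have "w * w' * (x * x') = (w * x) * (w' * x')" by (simp add: mult_ac)
  also have "\<dots> = of_nat p ^ (j + k) * (y * y') +
      T * (of_nat p ^ j * y * z' + of_nat p ^ k * y' * z + T * z * z')"
    unfolding x(5) x'(5) by (simp add: algebra_simps power_add)
  moreover have "of_nat p ^ j * y * z' + of_nat p ^ k * y' * z + T * z * z' \<in> S"
    by (intro S.add_closed S.mult_closed S.power_closed S.of_nat_closed T_in x x')
  ultimately show ?thesis
    using x x' by (intro I_I[of "w * w'"]) (auto simp: e.hom_mult)
qed

lemma S_subset_I_0: "x \<in> S \<Longrightarrow> x \<in> I 0"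
  using I_p_power_mult[of x 0] by simp

lemma I_mult_left: "s \<in> S \<Longrightarrow> x \<in> I k \<Longrightarrow> s * x \<in> I k"
  using I_mult[OF S_subset_I_0, of s x k] by simp

lemma I_diff: "x \<in> I k \<Longrightarrow> y \<in> I k \<Longrightarrow> x - y \<in> I k"
  using I_add[of x k "(- 1) * y"] I_mult_left[of "- 1" y k] by (auto intro: S.uminus_closed)

lemma I_sum: "(\<And>i. i \<in> A \<Longrightarrow> f i \<in> I k) \<Longrightarrow> sum f A \<in> I k"
  by (induction A rule: infinite_finite_induct) (auto simp: I_0 I_add)

lemma I_power: "x \<in> I j \<Longrightarrow> x ^ n \<in> I (n * j)"
  by (induction n) (auto simp: S_subset_I_0 I_mult)

lemma I_antimono:
  assumes "x \<in> I k" "j \<le> k"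
  shows "x \<in> I j"
proof -
  obtain w y z where x: "w \<in> S" "y \<in> S" "z \<in> S" "e w \<noteq> 0" "w * x = of_nat p ^ k * y + T * z"
    using assms(1) by (rule I_E)
  have "of_nat p ^ k * y = of_nat p ^ j * (of_nat p ^ (k - j) * y)"
    using assms(2) by (simp add: mult.assoc[symmetric] power_add[symmetric])
  then show ?thesis using x by (intro I_I[of w "of_nat p ^ (k - j) * y" z]) auto
qed

text \<open>An element outside the kernel of \<open>e\<close> acts as a unit: it is absorbed into
  the multiplier, which stays outside because \<open>'l\<close> is a field.\<close>

lemma I_cancel:
  assumes "s \<in> S" "e s \<noteq> 0" "s * x \<in> I k"
  shows "x \<in> I k"
proof -
  obtain w y z where x: "w \<in> S" "y \<in> S" "z \<in> S" "e w \<noteq> 0" "w * (s * x) = of_nat p ^ k * y + T * z"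
    using assms(3) by (rule I_E)
  then show ?thesis
    using assms by (intro I_I[of "w * s" y z]) (auto simp: e.hom_mult mult.assoc)
qed

lemma cong_p_imp_I: "cong_in S (of_nat p) x y \<Longrightarrow> x - y \<in> I 1"
  using I_p_power_mult[of _ 1] by (auto simp: cong_in_def)

lemma cong_T_imp_I: "cong_in S T x y \<Longrightarrow> x - y \<in> I k"
  using I_T_mult by (auto simp: cong_in_def)

text \<open>The multiplier is \<open>w = 1 - x ^ N\<close>, because \<open>x ^ (N + 1)\<close> agrees with \<open>x\<close> modulo \<open>(p, T)\<close>.\<close>

lemma kernel_subset_I_1:
  assumes x: "x \<in> S" and "e x = 0"
  shows "x \<in> I 1"
proof -
  define Q where "Q = p ^ (a * r)"
  have in_Z: "Poly_Mapping.lookup x k \<in> Z" for k using x by (auto simp: coeffs_in_def)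
  let ?s = "\<lambda>k. Poly_Mapping.single k (Poly_Mapping.lookup x k)"
  have xs: "x = (\<Sum>k\<in>Poly_Mapping.keys x. ?s k)"
    by (rule poly_mapping_sum_single) auto
  have "cong_in S (of_nat p) ((\<Sum>k\<in>Poly_Mapping.keys x. ?s k) ^ Q) (\<Sum>k\<in>Poly_Mapping.keys x. ?s k ^ Q)"
    unfolding Q_def using in_Z by (intro S.freshman_dream_sum_iterated prime_p single_in_S)
  then have 1: "x ^ Q - (\<Sum>k\<in>Poly_Mapping.keys x. ?s k ^ Q) \<in> I 1"
    unfolding xs[symmetric] by (rule cong_p_imp_I)
  \<comment> \<open>Modulo \<open>p\<close> the coefficient agrees with its \<open>Q\<close>-th
    power, and modulo \<open>T\<close> the exponent \<open>Q * k\<close> may be replaced by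
    \<open>k\<close>, since \<open>Q = N + 1\<close>.\<close>
  have 2: "?s k ^ Q - ?s k \<in> I 1" for k
  proof -
    let ?c = "Poly_Mapping.lookup x k"
    obtain z where z: "z \<in> Z" "?c ^ Q - ?c = of_nat p * z"
      using power_q_cong[OF in_Z, of k r] by (auto simp: cong_in_def Q_def)
    have "?s k ^ Q - Poly_Mapping.single (int Q * k) ?c = Poly_Mapping.single (int Q * k) (of_nat p * z)"
      by (simp add: single_power flip: single_diff z(2))
    also have "\<dots> = of_nat p ^ 1 * Poly_Mapping.single (int Q * k) z"
      by (simp add: mult_single flip: single_of_nat)
    also have "\<dots> \<in> I 1" using z by (intro I_p_power_mult single_in_S)
    finally have "?s k ^ Q - Poly_Mapping.single (int Q * k) ?c \<in> I 1" .
    moreover have "Poly_Mapping.single (int Q * k) ?c - ?s k \<in> I 1"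
      using in_Z by (intro cong_T_imp_I single_cong_T) (auto simp: Q_def Suc_N algebra_simps)
    ultimately have "(?s k ^ Q - Poly_Mapping.single (int Q * k) ?c) +
        (Poly_Mapping.single (int Q * k) ?c - ?s k) \<in> I 1" by (rule I_add)
    then show ?thesis by simp
  qed
  have "(\<Sum>k\<in>Poly_Mapping.keys x. ?s k ^ Q - ?s k) \<in> I 1" using 2 by (rule I_sum)
  then have "(\<Sum>k\<in>Poly_Mapping.keys x. ?s k ^ Q) - x \<in> I 1" by (simp add: sum_subtractf xs[symmetric])
  from I_add[OF 1 this] have "x ^ Q - x \<in> I 1" by simp
  from I_diff[OF I_0 this] have "(1 - x ^ N) * x \<in> I 1"
    by (simp add: Q_def Suc_N algebra_simps)
  moreover have "e (1 - x ^ N) = 1"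
    using x assms(2) N_gt_0 by (simp add: e.hom_diff e.hom_power e.hom_1 S.power_closed power_0_left)
  moreover have "1 - x ^ N \<in> S" using x by (intro S.diff_closed S.power_closed S.one_closed)
  ultimately show ?thesis using I_cancel[of "1 - x ^ N" x] by simp
qed

text \<open>Summing coefficients over residue classes modulo \<open>N\<close> kills \<open>T\<close>, and the multiplier of a
  constant in \<open>I k\<close> has a class sum that is a unit.\<close>

lemma constant_in_I:
  assumes "Poly_Mapping.single 0 c \<in> I k"
  shows "cong_in Z (of_nat p ^ k) c 0"
proof -
  interpret id: coeff_hom Z "\<lambda>c. c"
    by unfold_locales (auto simp: ring_hom_on_def)
  obtain w y z where w: "w \<in> S" "y \<in> S" "z \<in> S" "e w \<noteq> 0"
    "w * Poly_Mapping.single 0 c = of_nat p ^ k * y + T * z"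
    using assms by (rule I_E)
  define fold where "fold j = pm_eval (\<lambda>c. c) (\<lambda>i. if i mod int N = j then 1 else (0 :: 'Q))" for j
  have fold_in: "fold j x \<in> Z" if "x \<in> S" for x j
    unfolding fold_def pm_eval_def using that by (intro Z.sum_closed) (auto simp: coeffs_in_def)
  have fold_w: "c * fold j w = of_nat p ^ k * fold j y" for j
  proof -
    have pk: "(of_nat p ^ k :: 'Q) \<in> Z" "(of_nat p ^ k :: int \<Rightarrow>\<^sub>0 'Q) = Poly_Mapping.single 0 (of_nat p ^ k)"
      using Z.of_nat_closed[of "p ^ k"] by (simp, metis of_nat_power single_of_nat)
    \<comment> \<open>Multiplication by \<open>t ^ N\<close> preserves residue classes of exponents,
      so \<open>T * z + z\<close> and \<open>z\<close> have the same class sums.\<close>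
    have "fold j (T * z) + fold j z = fold j (T * z + z)"
      using w T_in by (simp add: fold_def id.pm_eval_add S.mult_closed)
    also have "T * z + z = Poly_Mapping.single (int N) 1 * z" by (simp add: T_def algebra_simps)
    also have "fold j \<dots> = fold j z"
      using w by (simp add: fold_def id.pm_eval_single_mult)
    finally have T0: "fold j (T * z) = 0" by simp
    have "fold j (w * Poly_Mapping.single 0 c) = of_nat p ^ k * fold j y"
      unfolding w(5) using w pk T_in T0 
      by (simp add: fold_def id.pm_eval_add S.mult_closed single_in_S id.pm_eval_single_mult)
    moreover have "fold j (Poly_Mapping.single 0 c * w) = c * fold j w"
    proof -
      have keys: "Poly_Mapping.keys (Poly_Mapping.single 0 c * w) \<subseteq> Poly_Mapping.keys w"
        by (auto simp: in_keys_iff lookup_single_mult)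
      show ?thesis
        unfolding fold_def
        by (subst id.pm_eval_eq_sum[OF _ keys]) (auto simp: pm_eval_def lookup_single_mult sum_distrib_left mult.assoc)
    qed
    ultimately show ?thesis by (simp add: mult.commute)
  qed
  \<comment> \<open>If all class sums reduced to \<open>0\<close>, then \<open>e w\<close> would
    vanish, because \<open>\<gamma> powi i\<close> depends only on \<open>i mod N\<close>.\<close>
  have "\<exists>j. red (fold j w) \<noteq> 0"
  proof (rule ccontr)
    assume "\<nexists>j. red (fold j w) \<noteq> 0"
    then have 0: "red (fold j w) = 0" for j by auto
    let ?K = "\<lambda>j. {i \<in> Poly_Mapping.keys w. i mod int N = j}"
    have "e w = (\<Sum>i\<in>Poly_Mapping.keys w. \<iota> (red (Poly_Mapping.lookup w i)) * \<gamma> powi (i mod int N))"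
      unfolding e_def pm_eval_def using \<gamma>_powi_mod by simp
    also have "\<dots> = (\<Sum>j\<in>(\<lambda>i. i mod int N) ` Poly_Mapping.keys w. \<Sum>i\<in>?K j.
        \<iota> (red (Poly_Mapping.lookup w i)) * \<gamma> powi (i mod int N))"
      by (rule sum.group[symmetric]) auto
    also have "\<dots> = (\<Sum>j\<in>(\<lambda>i. i mod int N) ` Poly_Mapping.keys w. \<iota> (red (fold j w)) * \<gamma> powi j)"
    proof (rule sum.cong[OF refl])
      fix j
      have "fold j w = (\<Sum>i\<in>?K j. Poly_Mapping.lookup w i)"
        unfolding fold_def pm_eval_def by (simp add: sum.inter_filter if_distrib cong: if_cong)
      then show "(\<Sum>i\<in>?K j. \<iota> (red (Poly_Mapping.lookup w i)) * \<gamma> powi (i mod int N)) =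
          \<iota> (red (fold j w)) * \<gamma> powi j"
        using w(1) by (simp add: \<iota>red.hom_sum coeffs_in_def sum_distrib_right)
    qed
    also have "\<dots> = 0" by (simp add: 0 \<iota>.hom_0)
    finally show False using w by simp
  qed
  then obtain j where "red (fold j w) \<noteq> 0" ..
  then have "v (fold j w) = 1" using red_nonzero fold_in w by blast
  then have "v c = v (c * fold j w)" by (simp add: v_mult)
  also have "\<dots> \<le> (1 / real p) ^ k"
    using fold_in[OF w(2), of j] v_nonneg
    by (simp add: fold_w v_mult v_p_power integer_ring_def mult_left_le)
  finally show ?thesis by (simp add: cong_0_iff)
qed

section \<open>Evaluation at lifted torus points and orthogonality of characters\<close>

definition dlog :: "'l \<Rightarrow> int" where
  "dlog y = int (SOME i. y = \<gamma> ^ i)"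

lemma \<gamma>_powi_dlog: "y \<noteq> 0 \<Longrightarrow> \<gamma> powi dlog y = y"
  unfolding dlog_def power_int_of_nat using someI_ex[OF \<gamma>_generates[of y]] by simp

definition expo :: "'l ^ 'n::finite \<Rightarrow> int ^ 'n \<Rightarrow> int" where
  "expo c u = (\<Sum>i\<in>UNIV. dlog (c $ i) * u $ i)"

lemma \<gamma>_powi_expo:
  "c \<in> torus \<Longrightarrow> \<gamma> powi expo c u = (\<Prod>i\<in>UNIV. (c $ i) powi (u $ i))"
  by (simp add: expo_def power_int_sum \<gamma>_nonzero power_int_mult \<gamma>_powi_dlog torus_def)

text \<open>Substitutes \<open>t ^ dlog (c $ i)\<close> for the \<open>i\<close>-th variable: modulo
  \<open>T\<close> this is an \<open>N\<close>-th root of unity, standing for the Teichmueller lift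
  of \<open>c $ i\<close>. The exponent chosen by \<open>dlog\<close> is unique up to multiples of
  \<open>N\<close>, so modulo \<open>T\<close> the substitution depends on \<open>c\<close>
  alone.\<close>

definition ev :: "'l ^ 'n::finite \<Rightarrow> ('n, 'Q) laurent \<Rightarrow> (int \<Rightarrow>\<^sub>0 'Q)" where
  "ev c = pm_eval (Poly_Mapping.single 0) (\<lambda>u. Poly_Mapping.single (expo c u) 1)"

lemma ev_eq: "ev c G = (\<Sum>u\<in>Poly_Mapping.keys G. Poly_Mapping.single (expo c u) (Poly_Mapping.lookup G u))"
  by (simp add: ev_def pm_eval_def mult_single)

lemma coeff_hom_ev: "coeff_hom (coeffs_in Z) (ev c)"
proof -
  interpret s: coeff_hom Z "Poly_Mapping.single (0 :: int)"
    by unfold_locales (rule ring_hom_on_single_0)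
  show ?thesis
    unfolding ev_def
    by (rule s.pm_eval_ring_hom) (auto simp: expo_def mult_single distrib_left sum.distrib)
qed

lemma ev_in: "G \<in> coeffs_in Z \<Longrightarrow> ev c G \<in> S"
  unfolding ev_eq by (intro S.sum_closed single_in_S) (auto simp: coeffs_in_def)

lemma ev_cong:
  assumes "cong_in (coeffs_in Z) (of_nat p) G H" "G \<in> coeffs_in Z" "H \<in> coeffs_in Z"
  shows "ev c G - ev c H \<in> I 1"
proof -
  interpret ev: coeff_hom "coeffs_in Z" "ev c" by (rule coeff_hom_ev)
  obtain X where X: "X \<in> coeffs_in Z" "G - H = of_nat p * X"
    using assms by (auto simp: cong_in_def)
  have "ev c G - ev c H = of_nat p ^ 1 * ev c X"
    using assms X by (simp add: ev.hom_mult ev.hom_of_nat flip: ev.hom_diff)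
  then show ?thesis using I_p_power_mult[OF ev_in[OF X(1)], where k = 1] by simp
qed

text \<open>\<open>\<gamma>\<close> to the power \<open>dlog (c $ i)\<close> is
  \<open>c $ i\<close>, so the lifted point reduces to \<open>c\<close>. This ties the condition
  \<open>e (ev c F) = 0\<close> to membership in \<open>V\<close>.\<close>

lemma e_ev:
  assumes "c \<in> torus" "G \<in> coeffs_in Z"
  shows "e (ev c G) = pm_eval (\<lambda>x. \<iota> (red x)) (\<lambda>u. \<Prod>i\<in>UNIV. (c $ i) powi (u $ i)) G"
proof -
  have "Poly_Mapping.lookup G u \<in> Z" for u using assms(2) by (auto simp: coeffs_in_def)
  then show ?thesis
    unfolding ev_eq pm_eval_def
    by (subst e.hom_sum) (simp_all add: single_in_S e_single \<gamma>_powi_expo[OF assms(1)])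
qed

text \<open>Translating the torus by \<open>d\<close> multiplies the sum by \<open>ev d (x^u)\<close>, and \<open>d\<close> can be chosen so that
  \<open>e\<close> does not send this factor to \<open>1\<close>.\<close>

lemma character_sum:
  fixes u :: "int ^ 'n::finite"
  assumes "\<not> int N dvd u $ i"
  shows "(\<Sum>c\<in>torus. Poly_Mapping.single (expo c u) 1) \<in> I k"
proof -
  define d :: "'l ^ 'n" where "d = (\<chi> j. if j = i then \<gamma> else 1)"
  define s where "s c = (Poly_Mapping.single (expo c u) 1 :: int \<Rightarrow>\<^sub>0 'Q)" for c :: "'l ^ 'n"
  have d: "d \<in> torus" using \<gamma>_nonzero by (simp add: torus_def d_def)
  \<comment> \<open>\<open>dlog\<close> need not turn products into sums, but
    \<open>\<gamma>\<close> has the same power at both exponents, so they differ by a multiple of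
    \<open>N\<close>, which is absorbed modulo \<open>T\<close>.\<close>
  have shift: "s d * s c - s (d * c) \<in> I k" if c: "c \<in> torus" for c
  proof -
    have "d * c \<in> torus" using c d by (simp add: torus_def)
    then have "\<gamma> powi (expo d u + expo c u - expo (d * c) u) = 1"
      using c d \<gamma>_nonzero
      by (simp add: power_int_add power_int_diff \<gamma>_powi_expo power_int_mult_distrib prod.distrib)
        (simp add: torus_def)
    then have "int N dvd expo d u + expo c u - expo (d * c) u" by (rule \<gamma>_powi_eq_1)
    then have "cong_in S T (Poly_Mapping.single (expo d u + expo c u) 1) (s (d * c))"
      unfolding s_def by (intro single_cong_T) auto
    then show ?thesis by (intro cong_T_imp_I) (simp add: s_def mult_single)
  qed
  have bij: "bij_betw ((*) d) torus torus"
  proof (rule bij_betwI[where g = "\<lambda>c. \<chi> j. c $ j / d $ j"])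
    show "(*) d \<in> torus \<rightarrow> torus" using d by (auto simp: torus_def)
    show "(\<lambda>c. \<chi> j. c $ j / d $ j) \<in> torus \<rightarrow> torus" using d by (auto simp: torus_def)
  qed (use d in \<open>auto simp: torus_def vec_eq_iff\<close>)
  have "(\<Sum>c\<in>torus. s d * s c - s (d * c)) \<in> I k" using shift by (rule I_sum)
  also have "(\<Sum>c\<in>torus. s d * s c - s (d * c)) = (s d - 1) * (\<Sum>c\<in>torus. s c)"
    unfolding sum_subtractf sum.reindex_bij_betw[OF bij, of s]
    by (simp only: sum_distrib_left[symmetric] left_diff_distrib mult_1_left)
  finally have "(s d - 1) * (\<Sum>c\<in>torus. s c) \<in> I k" .
  moreover have "s d - 1 \<in> S" by (auto simp: s_def intro!: single_in_S S.diff_closed)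
  moreover have "e (s d - 1) \<noteq> 0"
  proof
    assume "e (s d - 1) = 0"
    moreover have "e (s d - 1) = \<gamma> powi expo d u - 1"
      by (simp add: e.hom_diff e.hom_1 s_def single_in_S e_single \<iota>red.hom_1)
    moreover have "\<gamma> powi expo d u = \<gamma> powi (u $ i)"
    proof -
      have "(\<Prod>j\<in>UNIV. (d $ j) powi (u $ j)) = (\<Prod>j\<in>UNIV. if j = i then \<gamma> powi (u $ i) else 1)"
        by (intro prod.cong) (auto simp: d_def)
      then show ?thesis using \<gamma>_powi_expo[OF d, of u] by simp
    qed
    ultimately show False using \<gamma>_powi_eq_1[of "u $ i"] assms by simp
  qed
  ultimately show ?thesis unfolding s_def[symmetric] using I_cancel by blast
qed

text \<open>Sorted by the exponents \<open>u\<close> of \<open>G\<close>: if \<open>N\<close>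
  divides all coordinates of \<open>u\<close>, each monomial is \<open>1\<close> modulo
  \<open>T\<close> and the torus contributes its cardinality \<open>N ^ CARD('n)\<close>; otherwise
  \<open>character_sum\<close> applies.\<close>

lemma orthogonality:
  fixes G :: "('n::finite, 'Q) laurent"
  assumes G: "G \<in> coeffs_in Z"
  shows "(\<Sum>c\<in>torus. ev c G) - Poly_Mapping.single 0 (of_nat N ^ CARD('n) * divisible_sum N G) \<in> I k"
proof -
  let ?D = "\<lambda>u. \<forall>i. int N dvd u $ i"
  let ?g = "Poly_Mapping.lookup G"
  define \<Sigma> where "\<Sigma> u = (\<Sum>c\<in>(torus :: ('l ^ 'n) set). (Poly_Mapping.single (expo c u) 1 :: int \<Rightarrow>\<^sub>0 'Q))"
    for u :: "int ^ 'n"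
  have card: "card (torus :: ('l ^ 'n) set) = N ^ CARD('n)"
    using card_torus[OF finite_l] by (simp add: card_l N_def)
  have "Poly_Mapping.single 0 (?g u) * \<Sigma> u -
      Poly_Mapping.single 0 (of_nat N ^ CARD('n) * (if ?D u then ?g u else 0)) \<in> I k" for u
  proof (cases "?D u")
    case True
    have "Poly_Mapping.single (expo c u) 1 - 1 \<in> I k" for c :: "'l ^ 'n"
    proof -
      have "cong_in S T (Poly_Mapping.single (expo c u) 1) (Poly_Mapping.single 0 1)"
        using True by (intro single_cong_T) (auto simp: expo_def intro: dvd_sum)
      then show ?thesis using cong_T_imp_I by simp
    qed
    then have "(\<Sum>c\<in>(torus :: ('l ^ 'n) set). Poly_Mapping.single (expo c u) 1 - 1) \<in> I k" by (rule I_sum)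
    then have "\<Sigma> u - of_nat N ^ CARD('n) \<in> I k"
      by (simp add: sum_subtractf \<Sigma>_def card)
    then have "Poly_Mapping.single 0 (?g u) * (\<Sigma> u - of_nat N ^ CARD('n)) \<in> I k"
      using G by (intro I_mult_left single_in_S) (auto simp: coeffs_in_def)
    moreover have "(of_nat N ^ CARD('n) :: int \<Rightarrow>\<^sub>0 'Q) = Poly_Mapping.single 0 (of_nat N ^ CARD('n))"
      by (metis of_nat_power single_of_nat)
    ultimately show ?thesis using True by (simp add: right_diff_distrib mult_single mult.commute)
  next
    case False
    then obtain i where "\<not> int N dvd u $ i" by auto
    then have "\<Sigma> u \<in> I k" unfolding \<Sigma>_def by (rule character_sum)
    moreover have "Poly_Mapping.single 0 (?g u) \<in> S"
      using G by (intro single_in_S) (auto simp: coeffs_in_def)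
    ultimately show ?thesis using False by (auto intro: I_mult_left)
  qed
  then have "(\<Sum>u\<in>Poly_Mapping.keys G. Poly_Mapping.single 0 (?g u) * \<Sigma> u -
      Poly_Mapping.single 0 (of_nat N ^ CARD('n) * (if ?D u then ?g u else 0))) \<in> I k"
    by (rule I_sum)
  moreover have "(\<Sum>u\<in>Poly_Mapping.keys G. Poly_Mapping.single 0 (?g u) * \<Sigma> u) =
      (\<Sum>c\<in>torus. ev c G)"
    unfolding \<Sigma>_def sum_distrib_left ev_eq by (subst sum.swap) (simp add: mult_single)
  moreover have "(\<Sum>u\<in>Poly_Mapping.keys G.
      Poly_Mapping.single (0 :: int) (of_nat N ^ CARD('n) * (if ?D u then ?g u else 0))) =
      Poly_Mapping.single 0 (of_nat N ^ CARD('n) * divisible_sum N G)"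
  proof -
    have "divisible_sum N G = (\<Sum>u\<in>Poly_Mapping.keys G. if ?D u then ?g u else 0)"
      unfolding divisible_sum_def by (rule sum.inter_filter) simp
    then show ?thesis
      by (simp only: sum_distrib_left)
        (rule poly_mapping_eqI, simp add: lookup_sum lookup_single when_def)
  qed
  ultimately show ?thesis by (simp add: sum_subtractf)
qed

section \<open>Counting the points of \<open>V\<close>\<close>

lemma truncated_polynomial_at_point:
  fixes F :: "('n::finite, 'Q) laurent"
  assumes F: "F \<in> coeffs_in Z" and c: "c \<in> torus"
    and l: "l > 0" "\<tau> > 0" "l \<le> \<tau> * (a * r * (p - 1))"
  defines "g \<equiv> frob_prod F (a * r)"
  shows "(\<Sum>s = 0..l + \<tau> - 1. of_int (alpha_int l \<tau> s) * ev c g ^ s) -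
    (if e (ev c F) = 0 then 1 else 0) \<in> I l"
proof -
  interpret ev: coeff_hom "coeffs_in Z" "ev c" by (rule coeff_hom_ev)
  define y where "y = ev c g"
  have g: "g \<in> coeffs_in Z" using F frob_prod_in by (auto simp: g_def)
  have y: "y \<in> S" using ev_in g by (simp add: y_def)
  show ?thesis
  proof (cases "e (ev c F) = 0")
    case True
    \<comment> \<open>\<open>Frob ^^ i\<close> is a \<open>p ^ i\<close>-th power modulo
      \<open>p\<close>, and \<open>e\<close> kills \<open>ev c F\<close>; so each of the
      \<open>a * r * (p - 1)\<close> factors of \<open>y\<close> lies in \<open>I 1\<close>.\<close>
    have F1: "ev c ((Frob ^^ i) F) \<in> I 1" for i
    proof -
      have "ev c ((Frob ^^ i) F) - ev c (F ^ (p ^ i)) \<in> I 1"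
        using F by (intro ev_cong Frob_funpow_cong Frob_funpow_in ev.power_closed)
      moreover have "ev c (F ^ (p ^ i)) \<in> I 1"
        using F True p_gt_1
        by (intro kernel_subset_I_1)
          (auto simp: ev.hom_power e.hom_power ev_in S.power_closed power_0_left)
      ultimately have "(ev c ((Frob ^^ i) F) - ev c (F ^ (p ^ i))) + ev c (F ^ (p ^ i)) \<in> I 1"
        by (rule I_add)
      then show ?thesis by simp
    qed
    have "ev c (frob_prod F m) \<in> I (m * (p - 1))" for m
    proof (induction m)
      case 0
      then show ?case using S_subset_I_0[OF S.one_closed] by (simp add: frob_prod_def ev.hom_1)
    next
      case (Suc m)
      have "ev c (frob_prod F (Suc m)) = ev c (frob_prod F m) * ev c ((Frob ^^ m) F) ^ (p - 1)"
        using F by (simp add: frob_prod_def ev.hom_mult ev.hom_power ev.prod_closed ev.power_closed Frob_funpow_in)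
      moreover have "ev c ((Frob ^^ m) F) ^ (p - 1) \<in> I (p - 1)"
        using I_power[OF F1, of m "p - 1"] by simp
      ultimately show ?case using I_mult[OF Suc, of _ "p - 1"] by (simp add: add.commute)
    qed
    then have "y ^ \<tau> \<in> I (\<tau> * (a * r * (p - 1)))" unfolding y_def g_def by (rule I_power)
    \<comment> \<open>The bound relating \<open>l\<close> and \<open>\<tau>\<close> enters here: the
      generating polynomial differs from \<open>1\<close> by a multiple of
      \<open>y ^ \<tau>\<close>.\<close>
    then have y\<tau>: "y ^ \<tau> \<in> I l" using l(3) by (rule I_antimono)
    obtain R where R: "R \<in> S"
      "(1 - y) ^ l * (\<Sum>t<\<tau>. of_nat ((l + t - 1) choose t) * y ^ t) = 1 + y ^ \<tau> * R"
      using S.truncated_neg_binomial[OF y l(2), of l] by auto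
    have "(\<Sum>s = 0..l + \<tau> - 1. of_int (alpha_int l \<tau> s) * y ^ s) - 1 = R * y ^ \<tau>"
      unfolding alpha_int_generating[OF l(1)] R(2) by (simp add: mult.commute)
    with I_mult_left[OF R(1) y\<tau>] have "(\<Sum>s = 0..l + \<tau> - 1. of_int (alpha_int l \<tau> s) * y ^ s) - 1 \<in> I l"
      by simp
    then show ?thesis using True by (simp only: y_def simp_thms if_True)
  next
    case False
    \<comment> \<open>Off \<open>V\<close> the value \<open>e (ev c F)\<close> is non-zero in a
      field with \<open>N + 1\<close> elements, so its \<open>N\<close>-th power is
      \<open>1\<close>, and \<open>y\<close> agrees with \<open>1\<close> up to
      \<open>I 1\<close>.\<close>
    have "y - ev c (F ^ N) \<in> I 1"
      unfolding y_def g_def N_def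
      using F by (intro ev_cong frob_prod_cong frob_prod_in ev.power_closed)
    moreover have "ev c (F ^ N) - 1 \<in> I 1"
    proof (rule kernel_subset_I_1)
      show "ev c (F ^ N) - 1 \<in> S"
        using F by (intro S.diff_closed ev_in ev.power_closed S.one_closed)
      have "e (ev c F) ^ N = 1"
        using finite_field_power_card_minus_1[OF finite_l False] by (simp add: card_l N_def)
      then show "e (ev c (F ^ N) - 1) = 0"
        using F by (simp add: e.hom_diff e.hom_1 ev.hom_power e.hom_power ev_in S.power_closed)
    qed
    ultimately have "(y - ev c (F ^ N)) + (ev c (F ^ N) - 1) \<in> I 1" by (rule I_add)
    then have "y - 1 \<in> I 1" by simp
    from I_diff[OF I_0 this] have "(1 - y) ^ l \<in> I l" using I_power[of "1 - y" 1 l] by simp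
    then have "(\<Sum>t<\<tau>. of_nat ((l + t - 1) choose t) * y ^ t) * (1 - y) ^ l \<in> I l"
      by (intro I_mult_left S.sum_closed S.mult_closed S.power_closed S.of_nat_closed y)
    then have "(\<Sum>s = 0..l + \<tau> - 1. of_int (alpha_int l \<tau> s) * y ^ s) \<in> I l"
      unfolding alpha_int_generating[OF l(1)] by (simp add: mult.commute)
    then show ?thesis using False by (simp only: y_def if_False diff_0_right)
  qed
qed

text \<open>The torus sum is computed pointwise by \<open>truncated_polynomial_at_point\<close> and
  power by power by \<open>orthogonality\<close>. The difference is a constant in
  \<open>I l\<close>, which \<open>constant_in_I\<close> turns into a congruence in
  \<open>Z\<close>.\<close>

lemma point_count_cong:
  fixes F :: "('n::finite, 'Q) laurent"
  assumes F: "F \<in> coeffs_in Z" and l: "l > 0" "\<tau> > 0" "l \<le> \<tau> * (a * r * (p - 1))"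
  shows "cong_in Z (of_nat p ^ l) (of_nat (card {c \<in> torus. e (ev c F) = 0}))
    (of_nat N ^ CARD('n) * (\<Sum>s = 0..l + \<tau> - 1. of_int (alpha_int l \<tau> s) *
       divisible_sum N (frob_prod F (a * r) ^ s)))"
proof -
  define g where "g = frob_prod F (a * r)"
  define V where "V = {c \<in> (torus :: ('l ^ 'n) set). e (ev c F) = 0}"
  define tr where "tr s = of_nat N ^ CARD('n) * divisible_sum N (g ^ s)" for s
  let ?\<alpha> = "\<lambda>s. alpha_int l \<tau> s"
  have g: "g ^ s \<in> coeffs_in Z" for s
    using F by (auto simp: g_def intro!: subring_set.power_closed[OF coeffs_subring] frob_prod_in)
  have fin: "finite (torus :: ('l ^ 'n) set)" by (rule finite_torus[OF finite_l])
  have "(\<Sum>c\<in>(torus :: ('l ^ 'n) set). (\<Sum>s = 0..l + \<tau> - 1. of_int (?\<alpha> s) * ev c g ^ s) -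
      (if e (ev c F) = 0 then 1 else 0)) \<in> I l"
    unfolding g_def using l F by (intro I_sum truncated_polynomial_at_point)
  moreover have "(\<Sum>c\<in>(torus :: ('l ^ 'n) set). (if e (ev c F) = 0 then 1 else 0 :: int \<Rightarrow>\<^sub>0 'Q)) = of_nat (card V)"
    using fin by (simp add: V_def flip: sum.inter_filter)
  moreover have "(\<Sum>c\<in>(torus :: ('l ^ 'n) set). \<Sum>s = 0..l + \<tau> - 1. of_int (?\<alpha> s) * ev c g ^ s) =
      (\<Sum>s = 0..l + \<tau> - 1. of_int (?\<alpha> s) * (\<Sum>c\<in>torus. ev c (g ^ s)))"
  proof -
    have "ev c g ^ s = ev c (g ^ s)" for s and c :: "'l ^ 'n"
      using coeff_hom.hom_power[OF coeff_hom_ev, of g c s] g[of 1] by simp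
    then show ?thesis by (subst sum.swap) (simp add: sum_distrib_left)
  qed
  ultimately have 1: "(\<Sum>s = 0..l + \<tau> - 1. of_int (?\<alpha> s) * (\<Sum>c\<in>(torus :: ('l ^ 'n) set). ev c (g ^ s))) -
      of_nat (card V) \<in> I l"
    by (simp add: sum_subtractf)
  have "(\<Sum>s = 0..l + \<tau> - 1. of_int (?\<alpha> s) *
      ((\<Sum>c\<in>(torus :: ('l ^ 'n) set). ev c (g ^ s)) - Poly_Mapping.single 0 (tr s))) \<in> I l"
    unfolding tr_def by (intro I_sum I_mult_left orthogonality g S.of_int_closed)
  then have 2: "(\<Sum>s = 0..l + \<tau> - 1. of_int (?\<alpha> s) * (\<Sum>c\<in>(torus :: ('l ^ 'n) set). ev c (g ^ s))) -
      (\<Sum>s = 0..l + \<tau> - 1. of_int (?\<alpha> s) * Poly_Mapping.single 0 (tr s)) \<in> I l"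
    by (simp add: sum_subtractf right_diff_distrib)
  have "(\<Sum>s = 0..l + \<tau> - 1. of_int (?\<alpha> s) * Poly_Mapping.single 0 (tr s)) =
      Poly_Mapping.single (0 :: int) (\<Sum>s = 0..l + \<tau> - 1. of_int (?\<alpha> s) * tr s)"
    by (rule poly_mapping_eqI)
      (simp add: lookup_sum lookup_single when_def mult_single flip: single_of_int)
  with I_diff[OF 2 1]
  have "Poly_Mapping.single (0 :: int) (of_nat (card V) - (\<Sum>s = 0..l + \<tau> - 1. of_int (?\<alpha> s) * tr s)) \<in> I l"
    by (simp add: single_diff)
  from constant_in_I[OF this] show ?thesis
    by (simp add: cong_in_def V_def tr_def g_def sum_distrib_left mult.left_commute)
qed

end

section \<open>Assembly of the congruence\<close>

theorem theorem2p1: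
  fixes p a q r lam \<tau> :: nat
    and v :: "'Q::field_char_0 \<Rightarrow> real"
    and \<phi> :: "'Q \<Rightarrow> 'Q"
    and red :: "'Q \<Rightarrow> 'k::field"
    and \<iota> :: "'k \<Rightarrow> 'l::field"
    and K :: "(real ^ 'n::finite) set"
    and Fbar :: "('n, 'k) laurent"
    and F :: "('n, 'Q) laurent"
  assumes "prime p" and "q = p ^ a"
    and "unramified_padic_field p a v"
    and "frobenius_lift p v \<phi>"
    and "CARD('k) = q" and "reduction_map p v red"
    and "CARD('l) = q ^ r" and "ring_hom_on UNIV \<iota>"
    and "integral_polytope K"
    and "Fbar \<noteq> 0" and "newton_polytope Fbar \<subseteq> K"
    and "F \<in> integral_laurent v" and "\<And>u. red (Poly_Mapping.lookup F u) = Poly_Mapping.lookup Fbar u"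
    and "newton_polytope F \<subseteq> K"
    and "r > 0" and "lam > 0" and "\<tau> > 0"
    and "real \<tau> \<ge> real lam / ((real p - 1) * real a * real r)"
  shows "(\<forall>s\<in>{0..lam + \<tau> - 1}. alpha lam \<tau> s \<in> \<int>) \<and>
    cong_pow p v lam
    (of_nat (card (torus_points \<iota> Fbar)))
    ((of_nat q ^ r - 1) ^ CARD('n) *
      (\<Sum>s = 0..lam + \<tau> - 1.
         of_rat (alpha lam \<tau> s) *
         P_trace (dilate s K) (((A_op p v \<phi> (F ^ s)) ^^ a) ^^ r)))"
proof -
  have "frobenius_setting p a v \<phi> red"
    using assms by (simp add: frobenius_setting_def frobenius_setting_axioms_def)
  then interpret frobenius_setting p a v \<phi> red .
  have card_l: "CARD('l) = p ^ (a * r)" using assms by (simp add: power_mult)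
  then have "finite (UNIV :: 'l set)" using p_gt_1 by (intro card_ge_0_finite) auto
  then obtain \<gamma> :: 'l where \<gamma>: "\<gamma> \<noteq> 0" "\<And>y. y \<noteq> 0 \<Longrightarrow> \<exists>i::nat. y = \<gamma> ^ i"
    using finite_field_has_generator by blast
  interpret test_ring p a v \<phi> red \<iota> r \<gamma>
    by unfold_locales (use assms card_l \<gamma> in auto)

  have K: "convex K" "bounded K"
    using \<open>integral_polytope K\<close>
    by (auto simp: integral_polytope_def polytope_imp_convex polytope_imp_bounded)
  have F: "F \<in> coeffs_in Z" using \<open>F \<in> integral_laurent v\<close> by (simp add: integral_laurent_eq)
  have keys_F: "real_point u \<in> K" if "u \<in> Poly_Mapping.keys F" for u
    using that \<open>newton_polytope F \<subseteq> K\<close> hull_subset[of "real_point ` {u. Poly_Mapping.lookup F u \<noteq> 0}" convex]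
    by (auto simp: newton_polytope_def in_keys_iff)
  have F_P: "F \<in> P_module v (dilate 1 K)"
    using \<open>F \<in> integral_laurent v\<close> keys_F by (auto simp: P_module_def lattice_points_def dilate_def)
  \<comment> \<open>A vanishing coefficient of \<open>F\<close> reduces to \<open>0\<close>, so
    \<open>Fbar \<noteq> 0\<close> forces \<open>K\<close> to be non-empty, as the trace formula
    requires.\<close>
  have keys_Fbar: "Poly_Mapping.keys Fbar \<subseteq> Poly_Mapping.keys F"
    using assms(13) red.hom_0 by (metis in_keys_iff subsetI)
  moreover have "Poly_Mapping.keys Fbar \<noteq> {}" using \<open>Fbar \<noteq> 0\<close> by simp
  ultimately have K_ne: "K \<noteq> {}" using keys_F by blast

  \<comment> \<open>\<open>P_trace_A_op\<close> is applied to \<open>dilate s K\<close> and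
    \<open>F ^ s\<close>; \<open>frob_prod_power\<close> then exhibits the traces for all
    \<open>s\<close> through powers of a single polynomial.\<close>
  have trace: "P_trace (dilate s K) (((A_op p v \<phi> (F ^ s)) ^^ a) ^^ r) =
      divisible_sum N (frob_prod F (a * r) ^ s)" for s
  proof -
    have "F ^ s \<in> P_module v (dilate s K)"
      using P_module_power[OF padic_valued K(1) K_ne F_P, of s] by simp
    moreover have "bounded (dilate s K)" using K(2) by (simp add: dilate_def bounded_scaling)
    moreover have "dilate s K \<noteq> {}" using K_ne by (simp add: dilate_def)
    ultimately show ?thesis
      using P_trace_A_op[of "dilate s K" "F ^ s" r] K(1) F r_gt_0
      by (simp add: funpow_mult mult.commute convex_dilate N_def frob_prod_power)
  qed

  have "laurent_eval \<iota> Fbar c = e (ev c F)" if "c \<in> torus" for c :: "'l ^ 'n"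
  proof -
    have "laurent_eval \<iota> Fbar c = (\<Sum>u\<in>Poly_Mapping.keys F. \<iota> (Poly_Mapping.lookup Fbar u) *
        (\<Prod>i\<in>UNIV. (c $ i) powi (u $ i)))"
      unfolding laurent_eval_def
      using keys_Fbar by (intro sum.mono_neutral_left) (auto simp: in_keys_iff \<iota>.hom_0)
    then show ?thesis by (simp add: e_ev[OF that F] pm_eval_def assms(13))
  qed
  then have V: "torus_points \<iota> Fbar = {c \<in> torus. e (ev c F) = 0}"
    by (auto simp: torus_points_def torus_def)

  \<comment> \<open>The hypothesis on \<open>\<tau>\<close> with its positive denominator cleared,
    moved from reals to naturals.\<close>
  have "lam \<le> \<tau> * (a * r * (p - 1))"
  proof -
    have "(real p - 1) * real a * real r > 0" using p_gt_1 a_gt_0 r_gt_0 by simp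
    then have "real lam \<le> real \<tau> * ((real p - 1) * real a * real r)"
      using assms(18) by (simp add: divide_le_eq)
    also have "\<dots> = real (\<tau> * (a * r * (p - 1)))" using p_gt_1 by (simp add: of_nat_diff)
    finally show ?thesis by linarith
  qed
  from point_count_cong[OF F \<open>lam > 0\<close> \<open>\<tau> > 0\<close> this]
  have "cong_pow p v lam (of_nat (card (torus_points \<iota> Fbar)))
      (of_nat N ^ CARD('n) * (\<Sum>s = 0..lam + \<tau> - 1. of_int (alpha_int lam \<tau> s) *
        divisible_sum N (frob_prod F (a * r) ^ s)))"
    unfolding V cong_pow_eq .
  moreover have "(of_nat N :: 'Q) = of_nat q ^ r - 1"
    using p_gt_1 \<open>q = p ^ a\<close> by (simp add: N_def of_nat_diff power_mult)
  ultimately show ?thesis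
    using \<open>lam > 0\<close> by (simp add: trace alpha_eq_alpha_int)
qed

end
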